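(* Let $p \in \mathbb{N}$ and $\lambda > 0$. Let $\Gamma$ be a graph labelled by a set $S$, and let $H$ be a subgroup of index $h$ (finite or infinite) in $G(\Gamma)$. Then there exists a graph $\Gamma_H$ labelled by the set $S \times (G(\Gamma)/H)$ such that $G(\Gamma_H) \cong H * F_{h-1}$, where $F_{h-1}$ is the free group of rank $h-1$, and such that: \begin{itemize} \item if $\Gamma$ satisfies the $Gr(p)$-condition, then so does $\Gamma_H$; \item if $\Gamma$ satisfies the $Gr'(\lambda)$-condition, then so does $\Gamma_H$; \item if $\Gamma$ satisfies the $Gr'_*(\lambda)$-condition with respect to $F(S) = \ast_{P \in \Pi} F(P)$, where $\Pi$ is a partition of $S$, then $\Gamma_H$ satisfies the $Gr'_*(\lambda)$-condition with respect to $F(S \times G(\Gamma)/H) = \ast_{P \in \Pi} F\bigl(P \times G(\Gamma)/H\bigr)$. \end{itemize}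
   Context: Graphs may be disconnected, and may have loops and multiple edges. A labelling of a graph $\Gamma$ by a set $S$ is a choice of orientation on each edge together with a map assigning to each edge an element of $S$, called its label. For an edge-path $p$ on $\Gamma$, the label $\omega(p)$ of $p$ is the product of the labels of the edges traversed by $p$ in the free monoid on $S \sqcup S^{-1}$, where a letter is given exponent $+1$ if the corresponding edge is traversed in its direction and exponent $-1$ if it is traversed in the opposite direction. A graph $\Gamma$ labelled by $S$ defines the group $G(\Gamma)$ given by the presentation $\langle S \mid \text{labels of simple closed paths on } \Gamma \rangle$. A labelling is reduced if the labels of immersed (i.e. locally injective) paths are freely reduced words. A piece with respect to a labelled graph $\Gamma$ is a labelled path $p$ that has two essentially distinct (label-preserving) immersions $\iota_1, \iota_2 : p \to \Gamma$, where essentially distinct means that there does not exist a label-preserving automorphism $\phi : \Gamma \to \Gamma$ such that $\iota_1 = \phi \circ \iota_2$. $Gr(p)$-condition, for $p \in \mathbb{N}$: the labelling is reduced and no nontrivial simple closed path on $\Gamma$ is the concatenation of fewer than $p$ pieces. $Gr'_\ell(\lambda)$-condition, for $\lambda > 0$ and a length function $\ell$ on the free group $F(S)$ on $S$: the labelling is reduced and every piece $q$ that is a subpath of a nontrivial simple closed path $\gamma$ satisfies $\ell(\omega(q)) < \lambda\, \ell(\omega(\gamma))$. $Gr'(\lambda)$ denotes the $Gr'_\ell(\lambda)$-condition where $\ell$ is the word length (number of letters of the reduced word). Given a partition $\Pi$ of $S$, $Gr'_*(\lambda)$ with respect to $F(S) = \ast_{P \in \Pi} F(P)$ denotes the $Gr'_\ell(\lambda)$-condition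 where $\ell$ is the associated free product length, i.e. the number of factors in the normal form of an element with respect to the free product decomposition $F(S) = \ast_{P \in \Pi} F(P)$. The partition $\{P \times G(\Gamma)/H : P \in \Pi\}$ of $S \times G(\Gamma)/H$ defines the free product length on $F(S \times G(\Gamma)/H)$ used in the third item. $G(\Gamma)/H$ denotes the set of cosets of $H$ in $G(\Gamma)$, and $h = |G(\Gamma)/H|$ as a cardinal; when $h$ is infinite, $h - 1$ is understood as $h$. *)

theory Defs
  imports
    "HOL-Algebra.Coset"
    "HOL-Library.Sublist"
    "HOL-Library.Disjoint_Sets"
    "HOL-Library.Equipollence"
    "Graph_Theory.Digraph"
begin

section \<open>Free groups, presentations and free products\<close>

text \<open>A letter \<open>(s, True)\<close> stands for $s$ and \<open>(s, False)\<close> for $s^{-1}$, so words are the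
  elements of the free monoid on $S \sqcup S^{-1}$. The same encoding is used below for edges
  traversed along (\<open>True\<close>) or against (\<open>False\<close>) their orientation.\<close>

type_synonym 's word = "('s \<times> bool) list"

definition inv_letter :: "'s \<times> bool \<Rightarrow> 's \<times> bool" where
  "inv_letter x = (fst x, \<not> snd x)"

definition freely_reduced :: "'s word \<Rightarrow> bool" where
  "freely_reduced w \<longleftrightarrow> successively (\<lambda>x y. y \<noteq> inv_letter x) w"

fun cancel_cons :: "'s \<times> bool \<Rightarrow> 's word \<Rightarrow> 's word" where
  "cancel_cons x [] = [x]"
| "cancel_cons x (y # w) = (if y = inv_letter x then w else x # y # w)"

definition free_reduction :: "'s word \<Rightarrow> 's word" where
  "free_reduction w = foldr cancel_cons w []"

definition free_group :: "'s set \<Rightarrow> 's word monoid" where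
  "free_group S =
     \<lparr>carrier = {w. freely_reduced w \<and> fst ` set w \<subseteq> S},
      monoid.mult = (\<lambda>u v. free_reduction (u @ v)),
      one = []\<rparr>"

definition normal_closure :: "('a, 'b) monoid_scheme \<Rightarrow> 'a set \<Rightarrow> 'a set" where
  "normal_closure G R = (\<lambda>N. N \<lhd> G) hull R"

definition presented_group :: "'s set \<Rightarrow> 's word set \<Rightarrow> 's word set monoid" where
  "presented_group S R =
     free_group S Mod normal_closure (free_group S) (free_reduction ` R)"

text \<open>The free product is given by its standard presentation: all elements of both groups as
  generators, and the two multiplication tables as relators.\<close>

definition free_product ::
  "('a, 'm) monoid_scheme \<Rightarrow> ('b, 'n) monoid_scheme \<Rightarrow> ('a + 'b) word set monoid" where
  "free_product G K =
     presented_group (carrier G <+> carrier K)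
       ({[(Inl a, True), (Inl b, True), (Inl (a \<otimes>\<^bsub>G\<^esub> b), False)] | a b.
           a \<in> carrier G \<and> b \<in> carrier G} \<union>
        {[(Inr a, True), (Inr b, True), (Inr (a \<otimes>\<^bsub>K\<^esub> b), False)] | a b.
           a \<in> carrier K \<and> b \<in> carrier K})"

text \<open>\<open>B\<close> has cardinality $|C| - 1$, with the convention $\kappa - 1 = \kappa$ for infinite
  $\kappa$.\<close>

definition has_card_minus_one :: "'b set \<Rightarrow> 'c set \<Rightarrow> bool" where
  "has_card_minus_one B C \<longleftrightarrow>
     (if finite C then finite B \<and> card B = card C - 1 else B \<approx> C)"


section \<open>Length functions on free groups\<close>

text \<open>Elements of \<^term>\<open>free_group S\<close> are reduced words, so word length is \<^const>\<open>length\<close>.\<close>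

text \<open>Normal forms with respect to $F(S) = \ast_{P \in \mathcal{P}} F(P)$: sequences of nontrivial elements
  of the factors in which consecutive entries lie in different factors.\<close>

definition free_product_normal_form :: "'s set set \<Rightarrow> 's word list \<Rightarrow> bool" where
  "free_product_normal_form \<P> gs \<longleftrightarrow>
     (\<exists>Ps. list_all2 (\<lambda>P g. P \<in> \<P> \<and> g \<in> carrier (free_group P) \<and> g \<noteq> \<one>\<^bsub>free_group P\<^esub>) Ps gs \<and>
           successively (\<noteq>) Ps)"

definition free_product_length :: "'s set set \<Rightarrow> 's word \<Rightarrow> nat" where
  "free_product_length \<P> g =
     (let F = free_group (\<Union>\<P>) in
      THE n. \<exists>gs. free_product_normal_form \<P> gs \<and> foldr (monoid.mult F) gs \<one>\<^bsub>F\<^esub> = g \<and> length gs = n)"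


section \<open>Labelled graphs\<close>

text \<open>The arcs are the edges of an undirected multigraph together with their chosen
  orientations; paths below may traverse arcs in both directions.\<close>

record ('v, 'e, 's) labelled_graph = "('v, 'e) pre_digraph" +
  label :: "'e \<Rightarrow> 's"

definition labelled_by :: "'s set \<Rightarrow> ('v, 'e, 's) labelled_graph \<Rightarrow> bool" where
  "labelled_by S \<Gamma> \<longleftrightarrow>
     wf_digraph (pre_digraph.truncate \<Gamma>) \<and> (\<forall>e \<in> arcs \<Gamma>. label \<Gamma> e \<in> S)"

definition initial :: "('v, 'e, 's) labelled_graph \<Rightarrow> 'e \<times> bool \<Rightarrow> 'v" where
  "initial \<Gamma> d = (if snd d then tail \<Gamma> (fst d) else head \<Gamma> (fst d))"

definition terminal :: "('v, 'e, 's) labelled_graph \<Rightarrow> 'e \<times> bool \<Rightarrow> 'v" where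
  "terminal \<Gamma> d = (if snd d then head \<Gamma> (fst d) else tail \<Gamma> (fst d))"

fun edge_path ::
  "('v, 'e, 's) labelled_graph \<Rightarrow> 'v \<Rightarrow> ('e \<times> bool) list \<Rightarrow> 'v \<Rightarrow> bool" where
  "edge_path \<Gamma> u [] v \<longleftrightarrow> u \<in> verts \<Gamma> \<and> v = u"
| "edge_path \<Gamma> u (d # ds) v \<longleftrightarrow>
     fst d \<in> arcs \<Gamma> \<and> initial \<Gamma> d = u \<and> edge_path \<Gamma> (terminal \<Gamma> d) ds v"

definition path_label :: "('v, 'e, 's) labelled_graph \<Rightarrow> ('e \<times> bool) list \<Rightarrow> 's word" where
  "path_label \<Gamma> ds = map (map_prod (label \<Gamma>) id) ds"

text \<open>Local injectivity of an edge-path means that no edge is followed by the same edge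
  traversed backwards.\<close>

definition immersed_path ::
  "('v, 'e, 's) labelled_graph \<Rightarrow> 'v \<Rightarrow> ('e \<times> bool) list \<Rightarrow> bool" where
  "immersed_path \<Gamma> u ds \<longleftrightarrow>
     (\<exists>v. edge_path \<Gamma> u ds v) \<and> successively (\<lambda>d d'. d' \<noteq> inv_letter d) ds"

text \<open>Distinctness of the edges only excludes going back and forth along a single edge, which
  is not an injective image of a circle.\<close>

definition simple_closed_path ::
  "('v, 'e, 's) labelled_graph \<Rightarrow> 'v \<Rightarrow> ('e \<times> bool) list \<Rightarrow> bool" where
  "simple_closed_path \<Gamma> u ds \<longleftrightarrow>
     edge_path \<Gamma> u ds u \<and> distinct (map (initial \<Gamma>) ds) \<and> distinct (map fst ds)"

definition graph_group :: "'s set \<Rightarrow> ('v, 'e, 's) labelled_graph \<Rightarrow> 's word set monoid" where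
  "graph_group S \<Gamma> =
     presented_group S {path_label \<Gamma> ds | u ds. simple_closed_path \<Gamma> u ds}"


section \<open>Graphical small cancellation conditions\<close>

definition reduced_labelling :: "('v, 'e, 's) labelled_graph \<Rightarrow> bool" where
  "reduced_labelling \<Gamma> \<longleftrightarrow>
     (\<forall>u ds. immersed_path \<Gamma> u ds \<longrightarrow> freely_reduced (path_label \<Gamma> ds))"

definition label_automorphism ::
  "('v, 'e, 's) labelled_graph \<Rightarrow> ('v \<Rightarrow> 'v) \<Rightarrow> ('e \<Rightarrow> 'e) \<Rightarrow> bool" where
  "label_automorphism \<Gamma> \<phi>\<^sub>V \<phi>\<^sub>E \<longleftrightarrow>
     bij_betw \<phi>\<^sub>V (verts \<Gamma>) (verts \<Gamma>) \<and> bij_betw \<phi>\<^sub>E (arcs \<Gamma>) (arcs \<Gamma>) \<and>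
     (\<forall>e \<in> arcs \<Gamma>. tail \<Gamma> (\<phi>\<^sub>E e) = \<phi>\<^sub>V (tail \<Gamma> e) \<and>
                  head \<Gamma> (\<phi>\<^sub>E e) = \<phi>\<^sub>V (head \<Gamma> e) \<and>
                  label \<Gamma> (\<phi>\<^sub>E e) = label \<Gamma> e)"

text \<open>A labelled path is determined up to isomorphism by its label \<open>w\<close>; a label-preserving
  immersion of it into \<open>\<Gamma>\<close> is an immersed edge-path of \<open>\<Gamma>\<close>, given by its initial vertex and its
  edges, with label \<open>w\<close>.\<close>

definition immersion_of ::
  "'s word \<Rightarrow> ('v, 'e, 's) labelled_graph \<Rightarrow> 'v \<times> ('e \<times> bool) list \<Rightarrow> bool" where
  "immersion_of w \<Gamma> \<iota> \<longleftrightarrow> immersed_path \<Gamma> (fst \<iota>) (snd \<iota>) \<and> path_label \<Gamma> (snd \<iota>) = w"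

definition essentially_distinct ::
  "('v, 'e, 's) labelled_graph \<Rightarrow> 'v \<times> ('e \<times> bool) list \<Rightarrow> 'v \<times> ('e \<times> bool) list \<Rightarrow> bool" where
  "essentially_distinct \<Gamma> \<iota>\<^sub>1 \<iota>\<^sub>2 \<longleftrightarrow>
     \<not> (\<exists>\<phi>\<^sub>V \<phi>\<^sub>E. label_automorphism \<Gamma> \<phi>\<^sub>V \<phi>\<^sub>E \<and>
            \<iota>\<^sub>1 = map_prod \<phi>\<^sub>V (map (map_prod \<phi>\<^sub>E id)) \<iota>\<^sub>2)"

definition piece :: "('v, 'e, 's) labelled_graph \<Rightarrow> 's word \<Rightarrow> bool" where
  "piece \<Gamma> w \<longleftrightarrow>
     (\<exists>\<iota>\<^sub>1 \<iota>\<^sub>2. immersion_of w \<Gamma> \<iota>\<^sub>1 \<and> immersion_of w \<Gamma> \<iota>\<^sub>2 \<and> essentially_distinct \<Gamma> \<iota>\<^sub>1 \<iota>\<^sub>2)"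

definition Gr :: "nat \<Rightarrow> ('v, 'e, 's) labelled_graph \<Rightarrow> bool" where
  "Gr p \<Gamma> \<longleftrightarrow>
     reduced_labelling \<Gamma> \<and>
     \<not> (\<exists>u ds qs. simple_closed_path \<Gamma> u ds \<and> ds \<noteq> [] \<and> ds = concat qs \<and> length qs < p \<and>
            (\<forall>q \<in> set qs. piece \<Gamma> (path_label \<Gamma> q)))"

definition Gr'_len ::
  "('s word \<Rightarrow> nat) \<Rightarrow> real \<Rightarrow> ('v, 'e, 's) labelled_graph \<Rightarrow> bool" where
  "Gr'_len l lam \<Gamma> \<longleftrightarrow>
     reduced_labelling \<Gamma> \<and>
     (\<forall>u ds q. simple_closed_path \<Gamma> u ds \<longrightarrow> ds \<noteq> [] \<longrightarrow> sublist q ds \<longrightarrow>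
        piece \<Gamma> (path_label \<Gamma> q) \<longrightarrow>
        real (l (free_reduction (path_label \<Gamma> q)))
          < lam * real (l (free_reduction (path_label \<Gamma> ds))))"

definition Gr' :: "real \<Rightarrow> ('v, 'e, 's) labelled_graph \<Rightarrow> bool" where
  "Gr' lam \<Gamma> \<longleftrightarrow> Gr'_len length lam \<Gamma>"

definition Gr'_star :: "'s set set \<Rightarrow> real \<Rightarrow> ('v, 'e, 's) labelled_graph \<Rightarrow> bool" where
  "Gr'_star \<P> lam \<Gamma> \<longleftrightarrow> Gr'_len (free_product_length \<P>) lam \<Gamma>"

end

theory Submission
  imports Defs
begin

text \<open>Write $G = G(\Gamma)$ and let $C$ be the set of cosets of $H$. The graph \<open>\<Gamma>\<^sub>H\<close> has vertices
  \<open>verts \<Gamma> \<times> C\<close>, and an edge \<open>e\<close> of \<open>\<Gamma>\<close> labelled \<open>s\<close> lifts to edges \<open>(e, c)\<close> labelled \<open>(s, c)\<close> that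
  run from the sheet \<open>c\<close> to the sheet \<open>c s\<close>. Every closed path of \<open>\<Gamma>\<close> has trivial label in $G$, so
  \<open>\<Gamma>\<^sub>H\<close> is a disjoint union of copies of components of \<open>\<Gamma>\<close>: simple closed paths and pieces of \<open>\<Gamma>\<^sub>H\<close>
  project to those of \<open>\<Gamma>\<close>, with the same word length and free product length.

  The relators of \<open>\<Gamma>\<^sub>H\<close> are the lifts of the relators of \<open>\<Gamma>\<close>, so $G(\Gamma_H)$ is the universal group of
  the action groupoid of $G$ on $C$: it is generated by the arrows $(c, g)$ from $c$ to $cg$ subject to
  $(c, g)(cg, g') = (c, gg')$. Given a transversal $t$ with $t_H = 1$, it is isomorphic to $H * F(C
  \setminus \{H\})$ via $(c, g) \mapsto x_c^{-1} (t_c\, g\, t_{cg}^{-1}) x_{cg}$, where $x_H = 1$ and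
  the other $x_c$ are the free generators; the inverse sends $h$ to $(H, h)$ and $x_c$ to
  $(H, t_c)$.\<close>

section \<open>Free groups\<close>

lemma inv_letter_inv_letter [simp]: "inv_letter (inv_letter x) = x"
  by (simp add: inv_letter_def)

lemma inv_letter_simps [simp]: "inv_letter (s, b) = (s, \<not> b)"
  by (simp add: inv_letter_def)

lemma freely_reduced_Nil [simp]: "freely_reduced []"
  by (simp add: freely_reduced_def)

lemma freely_reduced_Cons:
  "freely_reduced (x # w) \<longleftrightarrow> freely_reduced w \<and> (w = [] \<or> hd w \<noteq> inv_letter x)"
  by (auto simp: freely_reduced_def successively_Cons)

lemma freely_reduced_cancel_cons: "freely_reduced w \<Longrightarrow> freely_reduced (cancel_cons x w)"
  by (cases w) (auto simp: freely_reduced_Cons)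

text \<open>Inverse letters act on reduced words by mutually inverse permutations. Reducedness
  enters when the head of \<open>w\<close> is cancelled: the next letter is not the inverse of
  \<open>x\<close>, so the outer step puts \<open>x\<close> back.\<close>

lemma cancel_cons_inv_letter:
  assumes "freely_reduced w"
  shows "cancel_cons x (cancel_cons (inv_letter x) w) = w"
proof (cases w)
  case (Cons y v)
  with assms show ?thesis by (cases v) (auto simp: freely_reduced_Cons)
qed simp

lemma freely_reduced_foldr_cancel_cons:
  "freely_reduced v \<Longrightarrow> freely_reduced (foldr cancel_cons u v)"
  by (induction u) (auto intro: freely_reduced_cancel_cons)

lemma freely_reduced_free_reduction [simp]: "freely_reduced (free_reduction w)"
  by (simp add: free_reduction_def freely_reduced_foldr_cancel_cons)

lemma free_reduction_Nil [simp]: "free_reduction [] = []"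
  by (simp add: free_reduction_def)

lemma free_reduction_Cons: "free_reduction (x # w) = cancel_cons x (free_reduction w)"
  by (simp add: free_reduction_def)

lemma free_reduction_reduced [simp]: "freely_reduced w \<Longrightarrow> free_reduction w = w"
proof (induction w)
  case (Cons x w)
  then show ?case by (cases w) (auto simp: free_reduction_Cons freely_reduced_Cons)
qed simp

text \<open>Cancelling a pair of inverse letters in \<open>u\<close> removes two mutually inverse
  permutations from the composite, so the action on reduced words is unchanged. Associativity of the
  multiplication in \<open>free_group\<close> rests on this.\<close>

lemma foldr_cancel_cons_free_reduction:
  assumes "freely_reduced v"
  shows "foldr cancel_cons (free_reduction u) v = foldr cancel_cons u v"
proof (induction u)
  case (Cons x u)
  have cancel: "foldr cancel_cons (cancel_cons x r) v = cancel_cons x (foldr cancel_cons r v)" for r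
  proof (cases r)
    case (Cons y r')
    show ?thesis
    proof (cases "y = inv_letter x")
      case True
      then show ?thesis using Cons assms
        by (simp add: cancel_cons_inv_letter freely_reduced_foldr_cancel_cons)
    qed (simp add: Cons)
  qed simp
  from Cons show ?case by (simp add: free_reduction_Cons cancel)
qed simp

lemma free_reduction_append: "free_reduction (u @ v) = foldr cancel_cons u (free_reduction v)"
  by (simp add: free_reduction_def)

lemma free_reduction_append_left [simp]: "free_reduction (free_reduction u @ v) = free_reduction (u @ v)"
  by (simp add: free_reduction_append foldr_cancel_cons_free_reduction)

lemma free_reduction_append_right [simp]: "free_reduction (u @ free_reduction v) = free_reduction (u @ v)"
  by (simp add: free_reduction_append)

lemma set_cancel_cons: "set (cancel_cons x w) \<subseteq> insert x (set w)"
  by (cases w) auto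

lemma set_free_reduction: "set (free_reduction w) \<subseteq> set w"
proof (induction w)
  case (Cons x w)
  then show ?case using set_cancel_cons[of x "free_reduction w"]
    by (auto simp: free_reduction_Cons)
qed simp

text \<open>Words need not be reduced here: relators and path labels are handled by plain
  concatenation, and reduction is postponed until an element of \<open>free_group S\<close> is
  required.\<close>

definition words :: "'s set \<Rightarrow> 's word set" where
  "words S = lists (S \<times> UNIV)"

lemma words_simps [simp]:
  "[] \<in> words S"
  "x # w \<in> words S \<longleftrightarrow> fst x \<in> S \<and> w \<in> words S"
  "u @ v \<in> words S \<longleftrightarrow> u \<in> words S \<and> v \<in> words S"
  by (cases x; auto simp: words_def)+

lemma words_iff: "w \<in> words S \<longleftrightarrow> fst ` set w \<subseteq> S"
  by (induction w) auto

lemma free_reduction_in_words [simp]: "w \<in> words S \<Longrightarrow> free_reduction w \<in> words S"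
  using set_free_reduction[of w] by (auto simp: words_iff)

definition inv_word :: "'s word \<Rightarrow> 's word" where
  "inv_word w = rev (map inv_letter w)"

lemma inv_word_simps [simp]:
  "inv_word [] = []"
  "inv_word (x # w) = inv_word w @ [inv_letter x]"
  "inv_word (u @ v) = inv_word v @ inv_word u"
  "inv_word (inv_word w) = w"
  by (simp_all add: inv_word_def rev_map comp_def)

lemma inv_word_in_words [simp]: "inv_word w \<in> words S \<longleftrightarrow> w \<in> words S"
  by (induction w) (auto simp: inv_letter_def)

lemma free_reduction_inv_word_append [simp]: "free_reduction (inv_word w @ w) = []"
proof (induction w)
  case (Cons x w)
  have "cancel_cons (inv_letter x) (cancel_cons x (free_reduction w)) = free_reduction w"
    using cancel_cons_inv_letter[of "free_reduction w" "inv_letter x"] by simp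
  with Cons show ?case by (simp add: free_reduction_append free_reduction_Cons)
qed simp

lemma free_reduction_append_inv_word [simp]: "free_reduction (w @ inv_word w) = []"
  using free_reduction_inv_word_append[of "inv_word w"] by simp

lemma carrier_free_group: "carrier (free_group S) = {w. freely_reduced w \<and> w \<in> words S}"
  by (simp add: free_group_def words_iff)

lemma mult_free_group [simp]: "u \<otimes>\<^bsub>free_group S\<^esub> v = free_reduction (u @ v)"
  and one_free_group [simp]: "\<one>\<^bsub>free_group S\<^esub> = []"
  by (simp_all add: free_group_def)

lemma group_free_group: "group (free_group S)"
proof (rule groupI)
  fix w assume "w \<in> carrier (free_group S)"
  then show "\<exists>v \<in> carrier (free_group S). v \<otimes>\<^bsub>free_group S\<^esub> w = \<one>\<^bsub>free_group S\<^esub>"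
    by (intro bexI[of _ "free_reduction (inv_word w)"]) (auto simp: carrier_free_group)
qed (auto simp: carrier_free_group)

lemma inv_free_group:
  assumes "w \<in> carrier (free_group S)"
  shows "inv\<^bsub>free_group S\<^esub> w = free_reduction (inv_word w)"
  using assms
  by (intro group.inv_equality[OF group_free_group]) (auto simp: carrier_free_group)

section \<open>Evaluation of words in a group\<close>

context group
begin

lemma mult_inv_cancel_left:
  "x \<in> carrier G \<Longrightarrow> y \<in> carrier G \<Longrightarrow> x \<otimes> (inv x \<otimes> y) = y"
  "x \<in> carrier G \<Longrightarrow> y \<in> carrier G \<Longrightarrow> inv x \<otimes> (x \<otimes> y) = y"
  by (simp_all flip: m_assoc)

lemma mult_inv_eq_oneD: "x \<otimes> inv y = \<one> \<Longrightarrow> x \<in> carrier G \<Longrightarrow> y \<in> carrier G \<Longrightarrow> x = y"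
  by (metis inv_closed inv_equality inv_inv)

definition letter_eval :: "('s \<Rightarrow> 'a) \<Rightarrow> 's \<times> bool \<Rightarrow> 'a" where
  "letter_eval f x = (if snd x then f (fst x) else inv f (fst x))"

definition word_eval :: "('s \<Rightarrow> 'a) \<Rightarrow> 's word \<Rightarrow> 'a" where
  "word_eval f w = foldr (\<lambda>x a. letter_eval f x \<otimes> a) w \<one>"

lemma word_eval_Nil [simp]: "word_eval f [] = \<one>"
  and word_eval_Cons: "word_eval f (x # w) = letter_eval f x \<otimes> word_eval f w"
  by (simp_all add: word_eval_def)

lemma letter_eval_closed: "f \<in> S \<rightarrow> carrier G \<Longrightarrow> fst x \<in> S \<Longrightarrow> letter_eval f x \<in> carrier G"
  by (auto simp: letter_eval_def)

lemma word_eval_closed: "f \<in> S \<rightarrow> carrier G \<Longrightarrow> w \<in> words S \<Longrightarrow> word_eval f w \<in> carrier G"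
  by (induction w) (auto simp: word_eval_Cons letter_eval_closed)

lemma word_eval_append:
  assumes "f \<in> S \<rightarrow> carrier G"
  shows "u \<in> words S \<Longrightarrow> v \<in> words S \<Longrightarrow> word_eval f (u @ v) = word_eval f u \<otimes> word_eval f v"
  using assms
  by (induction u) (auto simp: word_eval_Cons m_assoc letter_eval_closed word_eval_closed)

lemma word_eval_cancel_cons:
  assumes "f \<in> S \<rightarrow> carrier G" "fst x \<in> S" "w \<in> words S"
  shows "word_eval f (cancel_cons x w) = letter_eval f x \<otimes> word_eval f w"
proof (cases w)
  case (Cons y v)
  show ?thesis
  proof (cases "y = inv_letter x")
    case True
    have "letter_eval f x \<otimes> letter_eval f (inv_letter x) = \<one>"
      using funcset_mem[OF assms(1,2)] by (auto simp: letter_eval_def inv_letter_def)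
    then show ?thesis using Cons True assms
      by (simp add: word_eval_Cons m_assoc[symmetric] letter_eval_closed word_eval_closed)
  qed (simp add: Cons word_eval_Cons)
qed (simp add: word_eval_Cons)

lemma word_eval_free_reduction:
  assumes "f \<in> S \<rightarrow> carrier G"
  shows "w \<in> words S \<Longrightarrow> word_eval f (free_reduction w) = word_eval f w"
  by (induction w)
    (use assms in \<open>auto simp: free_reduction_Cons word_eval_cancel_cons word_eval_Cons\<close>)

text \<open>Existence half of the universal property of free groups. The product there is the
  reduction of a concatenation, and evaluation does not change under reduction.\<close>

lemma word_eval_hom:
  assumes "f \<in> S \<rightarrow> carrier G"
  shows "word_eval f \<in> hom (free_group S) G"
  using assms
  by (intro homI) (auto simp: carrier_free_group word_eval_closed word_eval_free_reduction word_eval_append)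

lemma word_eval_singleton: "f s \<in> carrier G \<Longrightarrow> word_eval f [(s, True)] = f s"
  by (simp add: word_eval_Cons letter_eval_def)

lemma word_eval_inv_word:
  assumes "f \<in> S \<rightarrow> carrier G" "w \<in> words S"
  shows "word_eval f (inv_word w) = inv (word_eval f w)"
proof -
  have "word_eval f (inv_word w) \<otimes> word_eval f w = word_eval f (free_reduction (inv_word w @ w))"
    using assms word_eval_free_reduction[OF assms(1), of "inv_word w @ w"]
      word_eval_append[OF assms(1), of "inv_word w" w] by simp
  then show ?thesis using assms by (intro inv_equality[symmetric]) (auto simp: word_eval_closed)
qed

end


section \<open>Presented groups\<close>

text \<open>The word is reduced first, because the cosets of the normal closure are taken in the
  group of reduced words. Classes can thus be formed of arbitrary words.\<close>

definition word_class :: "'s set \<Rightarrow> 's word set \<Rightarrow> 's word \<Rightarrow> 's word set" where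
  "word_class S R w = normal_closure (free_group S) (free_reduction ` R) #>\<^bsub>free_group S\<^esub> free_reduction w"

text \<open>The hull is an intersection of normal subgroups, taken over a family that contains the
  whole group and so is nonempty; subgroups and invariance under conjugation both survive
  intersections.\<close>

lemma (in group) normal_normal_closure:
  assumes "R \<subseteq> carrier G"
  shows "normal_closure G R \<lhd> G"
proof -
  have ne: "{N. N \<lhd> G \<and> R \<subseteq> N} \<noteq> {}"
    using assms subgroup_self by (auto simp: normal_inv_iff intro!: exI[of _ "carrier G"])
  have "subgroup (\<Inter> {N. N \<lhd> G \<and> R \<subseteq> N}) G"
    using ne by (intro subgroups_Inter) (auto intro: normal_imp_subgroup)
  then show ?thesis unfolding normal_closure_def hull_def normal_inv_iff
    by (auto simp: normal_inv_iff)
qed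

locale presentation =
  fixes S :: "'s set" and R :: "'s word set"
  assumes relators: "R \<subseteq> words S"
begin

abbreviation "N \<equiv> normal_closure (free_group S) (free_reduction ` R)"
abbreviation "P \<equiv> presented_group S R"
abbreviation "cls \<equiv> word_class S R"

lemma normal_N: "N \<lhd> free_group S"
  using relators by (intro group.normal_normal_closure[OF group_free_group]) (auto simp: carrier_free_group)

lemma group_presented: "group P"
  unfolding presented_group_def by (rule normal.factorgroup_is_group[OF normal_N])

lemma word_class_closed [simp]: "w \<in> words S \<Longrightarrow> cls w \<in> carrier P"
  by (auto simp: presented_group_def FactGroup_def word_class_def carrier_free_group
      intro!: group.rcosetsI[OF group_free_group] subgroup.subset normal_imp_subgroup[OF normal_N] )

lemma word_class_mult [simp]:
  "u \<in> words S \<Longrightarrow> v \<in> words S \<Longrightarrow> cls u \<otimes>\<^bsub>P\<^esub> cls v = cls (u @ v)"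
  by (simp add: presented_group_def FactGroup_def word_class_def normal.rcos_sum[OF normal_N]
      carrier_free_group)

lemma word_class_free_reduction [simp]: "cls (free_reduction w) = cls w"
  by (simp add: word_class_def)

lemma word_class_one_iff:
  assumes "w \<in> words S"
  shows "cls w = \<one>\<^bsub>P\<^esub> \<longleftrightarrow> free_reduction w \<in> N"
proof -
  have "free_reduction w \<in> carrier (free_group S)" using assms by (simp add: carrier_free_group)
  then show ?thesis
    using group.coset_join1[OF group_free_group] group.coset_join2[OF group_free_group]
      normal_imp_subgroup[OF normal_N]
    unfolding presented_group_def FactGroup_def word_class_def
    by (metis monoid.select_convs(2))
qed

lemma word_class_Nil [simp]: "cls [] = \<one>\<^bsub>P\<^esub>"
  by (simp add: word_class_one_iff subgroup.one_closed[OF normal_imp_subgroup[OF normal_N], simplified])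

lemma word_class_relator: "r \<in> R \<Longrightarrow> cls r = \<one>\<^bsub>P\<^esub>"
  using relators by (subst word_class_one_iff) (auto simp: normal_closure_def intro!: hull_inc)

lemma word_class_surj:
  assumes "a \<in> carrier P"
  obtains w where "w \<in> words S" "a = cls w"
proof -
  obtain w where "w \<in> carrier (free_group S)" "a = N #>\<^bsub>free_group S\<^esub> w"
    using assms by (auto simp: presented_group_def FactGroup_def RCOSETS_def)
  then show ?thesis by (intro that[of w]) (auto simp: word_class_def carrier_free_group)
qed

lemma word_class_cancel: "cls (inv_word w @ w) = \<one>\<^bsub>P\<^esub>" "cls (w @ inv_word w) = \<one>\<^bsub>P\<^esub>"
  using word_class_free_reduction[of "inv_word w @ w"] word_class_free_reduction[of "w @ inv_word w"]
  by simp_all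

lemma word_class_inv: "w \<in> words S \<Longrightarrow> cls (inv_word w) = inv\<^bsub>P\<^esub> cls w"
  by (rule group.inv_equality[OF group_presented, symmetric]) (simp_all add: word_class_cancel)

lemma word_class_append_inv_word:
  assumes "u \<in> words S" "v \<in> words S" "cls u = cls v"
  shows "cls (u @ inv_word v) = \<one>\<^bsub>P\<^esub>"
proof -
  have "cls (u @ inv_word v) = cls u \<otimes>\<^bsub>P\<^esub> cls (inv_word v)" using assms(1,2) by simp
  also have "\<dots> = cls v \<otimes>\<^bsub>P\<^esub> cls (inv_word v)" by (simp only: assms(3))
  also have "\<dots> = \<one>\<^bsub>P\<^esub>" using assms(2) by (simp add: word_class_cancel)
  finally show ?thesis .
qed

text \<open>The reduced words satisfying \<open>Q\<close> form a normal subgroup that contains the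
  reduced relators, hence the whole normal closure. Invariance under \<open>reduction\<close> allows
  all closure conditions to be stated for concatenations.\<close>

lemma word_class_induct:
  assumes w: "w \<in> words S" "cls w = \<one>\<^bsub>P\<^esub>"
    and relator: "\<And>r. r \<in> R \<Longrightarrow> Q r"
    and Nil: "Q []"
    and append: "\<And>u v. u \<in> words S \<Longrightarrow> v \<in> words S \<Longrightarrow> Q u \<Longrightarrow> Q v \<Longrightarrow> Q (u @ v)"
    and inverse: "\<And>u. u \<in> words S \<Longrightarrow> Q u \<Longrightarrow> Q (inv_word u)"
    and conj: "\<And>u v. u \<in> words S \<Longrightarrow> v \<in> words S \<Longrightarrow> Q u \<Longrightarrow> Q (v @ u @ inv_word v)"
    and reduction: "\<And>u. u \<in> words S \<Longrightarrow> Q (free_reduction u) \<longleftrightarrow> Q u"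
  shows "Q w"
proof -
  interpret F: group "free_group S" by (rule group_free_group)
  let ?M = "{u \<in> carrier (free_group S). Q u}"
  have "subgroup ?M (free_group S)"
    by unfold_locales
      (auto simp: carrier_free_group inv_free_group reduction Nil append inverse)
  then have "?M \<lhd> free_group S"
    unfolding F.normal_inv_iff
    by (auto simp: carrier_free_group inv_free_group reduction conj)
  moreover have "free_reduction ` R \<subseteq> ?M"
    using relators relator by (auto simp: carrier_free_group reduction subset_iff)
  ultimately have "N \<subseteq> ?M"
    unfolding normal_closure_def by (intro hull_minimal)
  with w show ?thesis by (auto simp: word_class_one_iff reduction)
qed

text \<open>Von Dyck's theorem: by \<open>word_class_induct\<close>, a map that kills the relators
  kills every word of trivial class, so evaluation depends only on the class.\<close>

lemma word_class_universal:
  assumes "group L" and f: "f \<in> S \<rightarrow> carrier L"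
    and rel: "\<And>r. r \<in> R \<Longrightarrow> group.word_eval L f r = \<one>\<^bsub>L\<^esub>"
  obtains \<phi> where "\<phi> \<in> hom P L" "\<And>w. w \<in> words S \<Longrightarrow> \<phi> (cls w) = group.word_eval L f w"
proof -
  interpret L: group L by fact
  interpret P: group P by (rule group_presented)
  have trivial: "L.word_eval f w = \<one>\<^bsub>L\<^esub>" if "w \<in> words S" "cls w = \<one>\<^bsub>P\<^esub>" for w
    by (rule word_class_induct[OF that])
      (use f in \<open>auto simp: rel L.word_eval_append[OF f] L.word_eval_inv_word[OF f]
        L.word_eval_free_reduction[OF f] L.word_eval_closed[OF f]\<close>)
  have wd: "L.word_eval f u = L.word_eval f v" if "u \<in> words S" "v \<in> words S" "cls u = cls v" for u v
  proof -
    have "cls (u @ inv_word v) = \<one>\<^bsub>P\<^esub>"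
      using that by (rule word_class_append_inv_word)
    then have "L.word_eval f u \<otimes>\<^bsub>L\<^esub> inv\<^bsub>L\<^esub> L.word_eval f v = \<one>\<^bsub>L\<^esub>"
      using trivial[of "u @ inv_word v"] that(1,2)
      by (simp add: L.word_eval_append[OF f] L.word_eval_inv_word[OF f])
    then show ?thesis
      by (rule L.mult_inv_eq_oneD) (use that in \<open>auto simp: L.word_eval_closed[OF f]\<close>)
  qed
  \<comment> \<open>The value is computed on a chosen representative; \<open>wd\<close> gives
    independence of the choice.\<close>
  define \<phi> where "\<phi> a = L.word_eval f (SOME w. w \<in> words S \<and> cls w = a)" for a
  have \<phi>: "\<phi> (cls w) = L.word_eval f w" if "w \<in> words S" for w
  proof -
    have "(SOME v. v \<in> words S \<and> cls v = cls w) \<in> words S \<and> cls (SOME v. v \<in> words S \<and> cls v = cls w) = cls w"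
      by (rule someI[of _ w]) (use that in simp)
    then show ?thesis unfolding \<phi>_def using that by (intro wd) auto
  qed
  have "\<phi> \<in> hom P L"
  proof (rule homI)
    fix a b assume "a \<in> carrier P" "b \<in> carrier P"
    then obtain u v where "u \<in> words S" "a = cls u" "v \<in> words S" "b = cls v"
      by (metis word_class_surj)
    then show "\<phi> a \<in> carrier L" "\<phi> (a \<otimes>\<^bsub>P\<^esub> b) = \<phi> a \<otimes>\<^bsub>L\<^esub> \<phi> b"
      by (simp_all add: \<phi> L.word_eval_closed[OF f] L.word_eval_append[OF f])
  qed
  with \<phi> show ?thesis using that by blast
qed

text \<open>Uniqueness half of the universal property: the class of a negative letter is the inverse
  of the class of the positive one, and a word is the product of its letters.\<close>

lemma hom_word_class:
  assumes "group L" "\<phi> \<in> hom P L" "w \<in> words S"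
  shows "\<phi> (cls w) = group.word_eval L (\<lambda>s. \<phi> (cls [(s, True)])) w"
proof -
  interpret L: group L by fact
  interpret group_hom P L \<phi>
    using assms group_presented by (simp add: group_hom_def group_hom_axioms_def)
  have "\<phi> (cls [x]) = L.letter_eval (\<lambda>s. \<phi> (cls [(s, True)])) x" if "fst x \<in> S" for x
  proof (cases "snd x")
    case False
    then have "[x] = inv_word [(fst x, True)]" by (cases x) simp
    then have "\<phi> (cls [x]) = inv\<^bsub>L\<^esub> \<phi> (cls [(fst x, True)])"
      using word_class_inv[of "[(fst x, True)]"] that by simp
    then show ?thesis using False by (simp add: L.letter_eval_def)
  qed (cases x; simp add: L.letter_eval_def)
  note letter = this
  show ?thesis using assms(3)
  proof (induction w)
    case (Cons x w)
    then have x: "fst x \<in> S" and w: "w \<in> words S" by simp_all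
    have "\<phi> (cls (x # w)) = \<phi> (cls [x] \<otimes>\<^bsub>P\<^esub> cls w)" using x w by simp
    also have "\<dots> = \<phi> (cls [x]) \<otimes>\<^bsub>L\<^esub> \<phi> (cls w)"
      using x w by (intro hom_mult) simp_all
    finally show ?case by (simp only: L.word_eval_Cons letter[OF x] Cons.IH[OF w])
  qed simp
qed

lemma hom_presented_eqI:
  assumes "group L" "\<phi> \<in> hom P L" "\<psi> \<in> hom P L"
    and "\<And>s. s \<in> S \<Longrightarrow> \<phi> (cls [(s, True)]) = \<psi> (cls [(s, True)])"
    and "a \<in> carrier P"
  shows "\<phi> a = \<psi> a"
proof -
  interpret L: group L by fact
  obtain w where w: "w \<in> words S" "a = cls w" using assms(5) by (rule word_class_surj)
  have "L.word_eval (\<lambda>s. \<phi> (cls [(s, True)])) w = L.word_eval (\<lambda>s. \<psi> (cls [(s, True)])) w"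
    using w(1) assms(4) by (induction w) (auto simp: L.word_eval_Cons L.letter_eval_def)
  then show ?thesis
    by (simp add: w hom_word_class[OF assms(1) assms(2) w(1)] hom_word_class[OF assms(1) assms(3) w(1)])
qed

end


text \<open>Elements of \<open>free_group B\<close> are reduced words and not classes, so uniqueness
  is shown here by splitting off the first letter; the rest of a reduced word is again
  reduced.\<close>

lemma hom_free_group_word_eval:
  assumes "group L" "\<phi> \<in> hom (free_group B) L" "w \<in> carrier (free_group B)"
  shows "\<phi> w = group.word_eval L (\<lambda>b. \<phi> [(b, True)]) w"
proof -
  interpret L: group L by fact
  interpret group_hom "free_group B" L \<phi>
    using assms group_free_group by (simp add: group_hom_def group_hom_axioms_def)
  have letter: "\<phi> [x] = L.letter_eval (\<lambda>b. \<phi> [(b, True)]) x" if "fst x \<in> B" for x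
  proof (cases "snd x")
    case False
    have gen: "[(fst x, True)] \<in> carrier (free_group B)"
      using that by (simp add: carrier_free_group freely_reduced_Cons)
    have "[x] = inv\<^bsub>free_group B\<^esub> [(fst x, True)]"
      using False gen by (cases x) (simp add: inv_free_group freely_reduced_Cons)
    then have "\<phi> [x] = inv\<^bsub>L\<^esub> \<phi> [(fst x, True)]"
      using gen by (simp only: hom_inv)
    then show ?thesis using False by (simp add: L.letter_eval_def)
  qed (cases x; simp add: L.letter_eval_def)
  show ?thesis using assms(3)
  proof (induction w)
    case Nil
    show ?case using hom_one by simp
  next
    case (Cons x w)
    then have x: "fst x \<in> B" and w: "w \<in> carrier (free_group B)"
      by (simp_all add: carrier_free_group freely_reduced_Cons)
    have "\<phi> (x # w) = \<phi> ([x] \<otimes>\<^bsub>free_group B\<^esub> w)"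
      using Cons.prems by (simp add: carrier_free_group)
    also have "\<dots> = \<phi> [x] \<otimes>\<^bsub>L\<^esub> \<phi> w"
      using x w by (intro hom_mult) (auto simp: carrier_free_group freely_reduced_Cons)
    finally show ?case by (simp only: L.word_eval_Cons letter[OF x] Cons.IH[OF w])
  qed
qed

lemma hom_free_group_eqI:
  assumes "group L" "\<phi> \<in> hom (free_group B) L" "\<psi> \<in> hom (free_group B) L"
    and "\<And>b. b \<in> B \<Longrightarrow> \<phi> [(b, True)] = \<psi> [(b, True)]"
    and "w \<in> carrier (free_group B)"
  shows "\<phi> w = \<psi> w"
proof -
  interpret L: group L by fact
  have "w \<in> words B" using assms(5) by (simp add: carrier_free_group)
  then have "L.word_eval (\<lambda>b. \<phi> [(b, True)]) w = L.word_eval (\<lambda>b. \<psi> [(b, True)]) w"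
    using assms(4) by (induction w) (auto simp: L.word_eval_Cons L.letter_eval_def)
  then show ?thesis
    by (simp add: hom_free_group_word_eval[OF assms(1) assms(2) assms(5)]
        hom_free_group_word_eval[OF assms(1) assms(3) assms(5)])
qed


section \<open>Free products\<close>

locale free_product_groups = G: group G + K: group K
  for G :: "('a, 'm) monoid_scheme" and K :: "('b, 'n) monoid_scheme"
begin

abbreviation "gens \<equiv> carrier G <+> carrier K"
definition "rels =
  {[(Inl a, True), (Inl b, True), (Inl (a \<otimes>\<^bsub>G\<^esub> b), False)] | a b. a \<in> carrier G \<and> b \<in> carrier G} \<union>
  {[(Inr a, True), (Inr b, True), (Inr (a \<otimes>\<^bsub>K\<^esub> b), False)] | a b. a \<in> carrier K \<and> b \<in> carrier K}"

sublocale FP: presentation gens rels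
  by unfold_locales (auto simp: rels_def)

lemma free_product_eq: "free_product G K = FP.P"
  by (simp add: free_product_def rels_def)

lemma group_free_product: "group (free_product G K)"
  unfolding free_product_eq by (rule FP.group_presented)

definition "inl a = FP.cls [(Inl a, True)]"
definition "inr b = FP.cls [(Inr b, True)]"

text \<open>A relator from a multiplication table is read as the equation \<open>z = x y\<close>.
  This makes both canonical maps into the free product homomorphisms.\<close>

lemma multiplication_relator:
  assumes "[(x, True), (y, True), (z, False)] \<in> rels"
  shows "FP.cls [(z, True)] = FP.cls [(x, True)] \<otimes>\<^bsub>FP.P\<^esub> FP.cls [(y, True)]"
proof -
  interpret P: group FP.P by (rule FP.group_presented)
  have in_gens: "x \<in> gens" "y \<in> gens" "z \<in> gens" using FP.relators assms by auto
  have "FP.cls ([(x, True), (y, True)] @ inv_word [(z, True)]) = \<one>\<^bsub>FP.P\<^esub>"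
    using FP.word_class_relator[OF assms] by simp
  then have "FP.cls [(x, True), (y, True)] \<otimes>\<^bsub>FP.P\<^esub> inv\<^bsub>FP.P\<^esub> FP.cls [(z, True)] = \<one>\<^bsub>FP.P\<^esub>"
    using in_gens by (subst FP.word_class_inv[symmetric]) simp_all
  then have "FP.cls [(z, True)] = FP.cls [(x, True), (y, True)]"
    by (rule P.mult_inv_eq_oneD[symmetric]) (use in_gens in simp_all)
  with in_gens show ?thesis by simp
qed

lemma inl_hom: "inl \<in> hom G (free_product G K)"
  unfolding free_product_eq
proof (rule homI)
  fix a b assume "a \<in> carrier G" "b \<in> carrier G"
  then show "inl (a \<otimes>\<^bsub>G\<^esub> b) = inl a \<otimes>\<^bsub>FP.P\<^esub> inl b"
    unfolding inl_def by (intro multiplication_relator) (auto simp: rels_def)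
qed (simp add: inl_def InlI)

lemma inr_hom: "inr \<in> hom K (free_product G K)"
  unfolding free_product_eq
proof (rule homI)
  fix a b assume "a \<in> carrier K" "b \<in> carrier K"
  then show "inr (a \<otimes>\<^bsub>K\<^esub> b) = inr a \<otimes>\<^bsub>FP.P\<^esub> inr b"
    unfolding inr_def by (intro multiplication_relator) (auto simp: rels_def)
qed (simp add: inr_def InrI)

text \<open>Homomorphisms respect multiplication tables, so \<open>case_sum f g\<close> sends all
  relators to the identity and the universal property of the presentation applies.\<close>

lemma free_product_universal:
  assumes "group L" and f: "f \<in> hom G L" and g: "g \<in> hom K L"
  obtains \<phi> where "\<phi> \<in> hom (free_product G K) L"
    "\<And>a. a \<in> carrier G \<Longrightarrow> \<phi> (inl a) = f a" "\<And>b. b \<in> carrier K \<Longrightarrow> \<phi> (inr b) = g b"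
proof -
  interpret L: group L by fact
  have in_L: "case_sum f g \<in> gens \<rightarrow> carrier L"
    using f g by (auto simp: hom_in_carrier)
  have "L.word_eval (case_sum f g) r = \<one>\<^bsub>L\<^esub>" if "r \<in> rels" for r
    using that f g
    by (auto simp: rels_def L.word_eval_Cons L.letter_eval_def hom_mult hom_in_carrier L.m_assoc[symmetric])
  then obtain \<phi> where \<phi>: "\<phi> \<in> hom FP.P L" "\<And>w. w \<in> words gens \<Longrightarrow> \<phi> (FP.cls w) = L.word_eval (case_sum f g) w"
    using FP.word_class_universal[OF assms(1) in_L] by metis
  show ?thesis
  proof (rule that[of \<phi>])
    show "\<phi> (inl a) = f a" if "a \<in> carrier G" for a
      using that f by (simp add: inl_def \<phi>(2) InlI L.word_eval_singleton hom_in_carrier)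
    show "\<phi> (inr b) = g b" if "b \<in> carrier K" for b
      using that g by (simp add: inr_def \<phi>(2) InrI L.word_eval_singleton hom_in_carrier)
  qed (simp add: free_product_eq \<phi>(1))
qed

lemma hom_free_product_eqI:
  assumes "group L" "\<phi> \<in> hom (free_product G K) L" "\<psi> \<in> hom (free_product G K) L"
    and "\<And>a. a \<in> carrier G \<Longrightarrow> \<phi> (inl a) = \<psi> (inl a)"
    and "\<And>b. b \<in> carrier K \<Longrightarrow> \<phi> (inr b) = \<psi> (inr b)"
    and "x \<in> carrier (free_product G K)"
  shows "\<phi> x = \<psi> x"
  by (rule FP.hom_presented_eqI[of L \<phi> \<psi>])
    (use assms in \<open>auto simp: free_product_eq inl_def inr_def\<close>)

end


section \<open>Lifting a presentation to the cosets of a subgroup\<close>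

text \<open>A lifted letter carries the sheet at the tail of its edge: the current sheet for a
  positive letter, the next sheet for a negative one. The action is a parameter so that the same
  recursion lifts words over \<open>S\<close> and edge-paths of \<Gamma>.\<close>

primrec lift_word :: "('c \<Rightarrow> 's \<times> bool \<Rightarrow> 'c) \<Rightarrow> 'c \<Rightarrow> 's word \<Rightarrow> ('s \<times> 'c) word" where
  "lift_word act c [] = []"
| "lift_word act c (x # w) =
     ((fst x, if snd x then c else act c x), snd x) # lift_word act (act c x) w"

lemma map_fst_lift_word [simp]: "map (map_prod fst id) (lift_word act c w) = w"
  by (induction w arbitrary: c) auto

locale presentation_subgroup = presentation S R for S :: "'s set" and R +
  fixes H assumes subgroup_H: "subgroup H P"
begin

sublocale G: group P by (rule group_presented)

abbreviation "C \<equiv> rcosets\<^bsub>P\<^esub> H"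
abbreviation act :: "'s word set set \<Rightarrow> 's \<times> bool \<Rightarrow> 's word set set"
  where "act c x \<equiv> c #>\<^bsub>P\<^esub> cls [x]"
abbreviation "lift \<equiv> lift_word act"

lemma coset_subset: "c \<in> C \<Longrightarrow> c \<subseteq> carrier P"
  using G.rcosets_part_G[OF subgroup_H] by auto

lemma coset_act_closed: "c \<in> C \<Longrightarrow> g \<in> carrier P \<Longrightarrow> c #>\<^bsub>P\<^esub> g \<in> C"
  by (auto simp: RCOSETS_def G.coset_mult_assoc subgroup.subset[OF subgroup_H])

lemma coset_act_mult:
  "c \<in> C \<Longrightarrow> g \<in> carrier P \<Longrightarrow> h \<in> carrier P \<Longrightarrow> (c #>\<^bsub>P\<^esub> g) #>\<^bsub>P\<^esub> h = c #>\<^bsub>P\<^esub> (g \<otimes>\<^bsub>P\<^esub> h)"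
  by (simp add: G.coset_mult_assoc coset_subset)

lemma coset_act_one [simp]: "c \<in> C \<Longrightarrow> c #>\<^bsub>P\<^esub> \<one>\<^bsub>P\<^esub> = c"
  by (simp add: coset_subset)

lemma H_in_cosets: "H \<in> C"
  using G.rcosetsI[of H "\<one>\<^bsub>P\<^esub>"] by (simp add: subgroup.subset[OF subgroup_H])

lemma coset_act_cls: "c \<in> C \<Longrightarrow> w \<in> words S \<Longrightarrow> c #>\<^bsub>P\<^esub> cls w \<in> C"
  by (simp add: coset_act_closed)

lemma coset_act_append:
  "c \<in> C \<Longrightarrow> u \<in> words S \<Longrightarrow> v \<in> words S \<Longrightarrow> (c #>\<^bsub>P\<^esub> cls u) #>\<^bsub>P\<^esub> cls v = c #>\<^bsub>P\<^esub> cls (u @ v)"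
  by (simp add: coset_act_mult)

lemma coset_act_Cons:
  "c \<in> C \<Longrightarrow> fst x \<in> S \<Longrightarrow> w \<in> words S \<Longrightarrow> (c #>\<^bsub>P\<^esub> cls [x]) #>\<^bsub>P\<^esub> cls w = c #>\<^bsub>P\<^esub> cls (x # w)"
  by (simp add: coset_act_append)

lemma coset_act_inv_word:
  "c \<in> C \<Longrightarrow> w \<in> words S \<Longrightarrow> (c #>\<^bsub>P\<^esub> cls w) #>\<^bsub>P\<^esub> cls (inv_word w) = c"
  by (simp add: coset_act_append word_class_cancel)

lemma act_inv_letter: "c \<in> C \<Longrightarrow> fst x \<in> S \<Longrightarrow> act (act c x) (inv_letter x) = c"
  using coset_act_inv_word[of c "[x]"] by simp

section \<open>Lifts of words and relators\<close>

lemma lift_in_words: "w \<in> words S \<Longrightarrow> c \<in> C \<Longrightarrow> lift c w \<in> words (S \<times> C)"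
  by (induction w arbitrary: c) (auto simp: coset_act_cls)

lemma lift_append:
  "u \<in> words S \<Longrightarrow> v \<in> words S \<Longrightarrow> c \<in> C \<Longrightarrow> lift c (u @ v) = lift c u @ lift (c #>\<^bsub>P\<^esub> cls u) v"
  by (induction u arbitrary: c) (auto simp: coset_act_cls coset_act_Cons)

text \<open>These are the boundary words of the 2-cells in the cover of the presentation complex
  that belongs to \<open>H\<close>. The group \<open>L.P\<close> is the fundamental group of this
  cover after all its vertices, the cosets, are identified to one; the identification accounts for
  the free factor.\<close>

definition "lifted_relators = {lift c r | c r. c \<in> C \<and> r \<in> R}"

sublocale L: presentation "S \<times> C" lifted_relators
  using relators by unfold_locales (auto simp: lifted_relators_def intro!: lift_in_words)

sublocale LG: group L.P by (rule L.group_presented)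

text \<open>A letter followed by its inverse lifts to an edge traversed back and forth, since
  \<open>act_inv_letter\<close> returns to the sheet \<open>c\<close>. The lift of the pair is
  therefore \<open>[?z] @ inv_word [?z]\<close>, which is trivial in \<open>L.P\<close>.\<close>

lemma lifted_class_free_reduction:
  "w \<in> words S \<Longrightarrow> c \<in> C \<Longrightarrow> L.cls (lift c (free_reduction w)) = L.cls (lift c w)"
proof (induction w arbitrary: c)
  case (Cons x w)
  have cancel: "L.cls (lift c (cancel_cons x v)) = L.cls (lift c (x # v))" if "v \<in> words S" for v
  proof (cases v)
    case (Cons y u)
    show ?thesis
    proof (cases "y = inv_letter x")
      case True
      let ?z = "((fst x, if snd x then c else act c x), snd x)"
      have "lift c (x # v) = [?z] @ inv_word [?z] @ lift c u"
        using Cons.prems True act_inv_letter[of c x] \<open>v = y # u\<close>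
        by (cases x; cases "snd x") simp_all
      moreover have "L.cls ([?z] @ inv_word [?z] @ lift c u) = L.cls ([?z] @ inv_word [?z]) \<otimes>\<^bsub>L.P\<^esub> L.cls (lift c u)"
        using Cons.prems that \<open>v = y # u\<close>
        by (subst L.word_class_mult) (auto simp: coset_act_cls lift_in_words)
      ultimately have "L.cls (lift c (x # v)) = L.cls (lift c u)"
        using Cons.prems that \<open>v = y # u\<close> by (simp only: L.word_class_cancel) (simp add: lift_in_words)
      then show ?thesis using True \<open>v = y # u\<close> by simp
    qed (simp add: Cons)
  qed simp
  have "L.cls (lift c (x # v)) = L.cls [((fst x, if snd x then c else act c x), snd x)] \<otimes>\<^bsub>L.P\<^esub> L.cls (lift (act c x) v)"
    if "v \<in> words S" for v
    using that Cons.prems by (simp add: coset_act_cls lift_in_words)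
  with cancel Cons show ?case
    by (simp add: free_reduction_Cons coset_act_cls)
qed simp

lemma lifted_class_append:
  "u \<in> words S \<Longrightarrow> v \<in> words S \<Longrightarrow> c \<in> C \<Longrightarrow>
    L.cls (lift c (u @ v)) = L.cls (lift c u) \<otimes>\<^bsub>L.P\<^esub> L.cls (lift (c #>\<^bsub>P\<^esub> cls u) v)"
  by (simp add: lift_append lift_in_words coset_act_cls)

text \<open>The inverse word has to be lifted from the sheet in which the lift of \<open>w\<close>
  ends; followed by that lift it reduces to the empty word.\<close>

lemma lifted_class_inv_word:
  assumes "w \<in> words S" "c \<in> C"
  shows "L.cls (lift (c #>\<^bsub>P\<^esub> cls w) (inv_word w)) = inv\<^bsub>L.P\<^esub> L.cls (lift c w)"
proof -
  let ?d = "c #>\<^bsub>P\<^esub> cls w"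
  have "L.cls (lift ?d (inv_word w)) \<otimes>\<^bsub>L.P\<^esub> L.cls (lift c w) = L.cls (lift ?d (inv_word w @ w))"
    using assms by (simp add: lifted_class_append coset_act_cls coset_act_inv_word)
  also have "\<dots> = L.cls (lift ?d (free_reduction (inv_word w @ w)))"
    using assms by (subst lifted_class_free_reduction) (simp_all add: coset_act_cls)
  finally show ?thesis
    using assms by (intro LG.inv_equality[symmetric]) (auto simp: lift_in_words coset_act_cls)
qed

lemma lifted_class_trivial:
  assumes "w \<in> words S" "cls w = \<one>\<^bsub>P\<^esub>" "c \<in> C"
  shows "L.cls (lift c w) = \<one>\<^bsub>L.P\<^esub>"
proof -
  \<comment> \<open>The first conjunct says that all lifts of the word return to their starting
    sheet, which the cases of products, inverses and conjugates need. All sheets are treated at once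
    because a conjugating word changes the sheet.\<close>
  have "cls w = \<one>\<^bsub>P\<^esub> \<and> (\<forall>c \<in> C. L.cls (lift c w) = \<one>\<^bsub>L.P\<^esub>)"
  proof (rule word_class_induct[OF assms(1,2)])
    fix r assume "r \<in> R"
    then show "cls r = \<one>\<^bsub>P\<^esub> \<and> (\<forall>c \<in> C. L.cls (lift c r) = \<one>\<^bsub>L.P\<^esub>)"
      using L.word_class_relator by (auto simp: word_class_relator lifted_relators_def)
  next
    fix u v assume *: "u \<in> words S" "v \<in> words S"
      "cls u = \<one>\<^bsub>P\<^esub> \<and> (\<forall>c \<in> C. L.cls (lift c u) = \<one>\<^bsub>L.P\<^esub>)"
      "cls v = \<one>\<^bsub>P\<^esub> \<and> (\<forall>c \<in> C. L.cls (lift c v) = \<one>\<^bsub>L.P\<^esub>)"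
    then have "cls (u @ v) = \<one>\<^bsub>P\<^esub>" using word_class_mult[of u v] by simp
    with * show "cls (u @ v) = \<one>\<^bsub>P\<^esub> \<and> (\<forall>c \<in> C. L.cls (lift c (u @ v)) = \<one>\<^bsub>L.P\<^esub>)"
      by (simp add: lifted_class_append)
  next
    fix u assume *: "u \<in> words S" "cls u = \<one>\<^bsub>P\<^esub> \<and> (\<forall>c \<in> C. L.cls (lift c u) = \<one>\<^bsub>L.P\<^esub>)"
    have "L.cls (lift c (inv_word u)) = \<one>\<^bsub>L.P\<^esub>" if "c \<in> C" for c
      using lifted_class_inv_word[of u c] * that by simp
    with * show "cls (inv_word u) = \<one>\<^bsub>P\<^esub> \<and> (\<forall>c \<in> C. L.cls (lift c (inv_word u)) = \<one>\<^bsub>L.P\<^esub>)"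
      by (simp add: word_class_inv)
  next
    fix u v assume *: "u \<in> words S" "v \<in> words S"
      "cls u = \<one>\<^bsub>P\<^esub> \<and> (\<forall>c \<in> C. L.cls (lift c u) = \<one>\<^bsub>L.P\<^esub>)"
    have "cls (v @ u @ inv_word v) = cls v \<otimes>\<^bsub>P\<^esub> (cls u \<otimes>\<^bsub>P\<^esub> cls (inv_word v))"
      using *(1,2) by simp
    then have "cls (v @ u @ inv_word v) = \<one>\<^bsub>P\<^esub>"
      using * by (simp add: word_class_cancel)
    moreover have "L.cls (lift c (v @ u @ inv_word v)) = \<one>\<^bsub>L.P\<^esub>" if "c \<in> C" for c
      using * that
      by (simp add: lifted_class_append coset_act_cls lifted_class_inv_word lift_in_words)
    ultimately show "cls (v @ u @ inv_word v) = \<one>\<^bsub>P\<^esub> \<and>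
        (\<forall>c \<in> C. L.cls (lift c (v @ u @ inv_word v)) = \<one>\<^bsub>L.P\<^esub>)"
      by blast
  qed (auto simp: lifted_class_free_reduction)
  with assms(3) show ?thesis by blast
qed

lemma lifted_class_cong:
  assumes "u \<in> words S" "v \<in> words S" "cls u = cls v" "c \<in> C"
  shows "L.cls (lift c u) = L.cls (lift c v)"
proof -
  have "cls (u @ inv_word v) = \<one>\<^bsub>P\<^esub>"
    using assms(1-3) by (rule word_class_append_inv_word)
  then have "L.cls (lift c (u @ inv_word v)) = \<one>\<^bsub>L.P\<^esub>"
    using assms by (intro lifted_class_trivial) auto
  then have "L.cls (lift c u) \<otimes>\<^bsub>L.P\<^esub> inv\<^bsub>L.P\<^esub> L.cls (lift c v) = \<one>\<^bsub>L.P\<^esub>"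
    using assms by (simp add: lifted_class_append lifted_class_inv_word)
  then show ?thesis
    by (rule LG.mult_inv_eq_oneD) (use assms in \<open>simp_all add: lift_in_words\<close>)
qed

text \<open>The image of the arrow from \<open>c\<close> to \<open>c g\<close> in the action groupoid of \<open>P\<close> on the cosets.\<close>

definition "arrow c g = L.cls (lift c (SOME w. w \<in> words S \<and> cls w = g))"

lemma arrow_cls:
  assumes "c \<in> C" "w \<in> words S"
  shows "arrow c (cls w) = L.cls (lift c w)"
proof -
  have "(SOME v. v \<in> words S \<and> cls v = cls w) \<in> words S \<and> cls (SOME v. v \<in> words S \<and> cls v = cls w) = cls w"
    by (rule someI[of _ w]) (use assms in simp)
  with assms show ?thesis unfolding arrow_def by (intro lifted_class_cong) auto
qed

lemma arrow_closed: "c \<in> C \<Longrightarrow> g \<in> carrier P \<Longrightarrow> arrow c g \<in> carrier L.P"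
  by (metis arrow_cls lift_in_words L.word_class_closed word_class_surj)

lemma arrow_mult:
  assumes "c \<in> C" "g \<in> carrier P" "h \<in> carrier P"
  shows "arrow c (g \<otimes>\<^bsub>P\<^esub> h) = arrow c g \<otimes>\<^bsub>L.P\<^esub> arrow (c #>\<^bsub>P\<^esub> g) h"
proof -
  obtain u v where "u \<in> words S" "g = cls u" "v \<in> words S" "h = cls v"
    using assms(2,3) by (metis word_class_surj)
  then show ?thesis using assms(1)
    by (simp add: arrow_cls coset_act_cls lifted_class_append)
qed

lemma arrow_one: "c \<in> C \<Longrightarrow> arrow c \<one>\<^bsub>P\<^esub> = \<one>\<^bsub>L.P\<^esub>"
  using arrow_cls[of c "[]"] by simp

end


section \<open>Schreier transversal and comparison with the free product\<close>

context presentation_subgroup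
begin

text \<open>The value at \<open>H\<close> is fixed to be the identity so that arrows from
  \<open>H\<close> to itself need no correction by a coset representative.\<close>

definition transversal :: "'s word set set \<Rightarrow> 's word set" where
  "transversal c = (if c = H then \<one>\<^bsub>P\<^esub> else SOME g. g \<in> carrier P \<and> H #>\<^bsub>P\<^esub> g = c)"

lemma transversal:
  assumes "c \<in> C"
  shows "transversal c \<in> carrier P" "H #>\<^bsub>P\<^esub> transversal c = c"
proof -
  have "\<exists>g. g \<in> carrier P \<and> H #>\<^bsub>P\<^esub> g = c" using assms by (auto simp: RCOSETS_def)
  from someI_ex[OF this] show "transversal c \<in> carrier P" "H #>\<^bsub>P\<^esub> transversal c = c"
    using coset_act_one[OF H_in_cosets] by (auto simp: transversal_def)
qed

lemma transversal_subgroup [simp]: "transversal H = \<one>\<^bsub>P\<^esub>"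
  by (simp add: transversal_def)

lemma subgroup_act: "h \<in> H \<Longrightarrow> H #>\<^bsub>P\<^esub> h = H"
  using G.coset_join2 subgroup.mem_carrier[OF subgroup_H] subgroup_H by blast

text \<open>Both \<open>transversal c\<close> times \<open>g\<close> and the representative of the
  coset of \<open>c\<close> moved by \<open>g\<close> carry \<open>H\<close> to the same coset, so
  their quotient stabilises \<open>H\<close>. These elements are the Schreier generators when
  \<open>g\<close> runs through the generators.\<close>

lemma schreier_element:
  assumes "c \<in> C" "g \<in> carrier P"
  shows "transversal c \<otimes>\<^bsub>P\<^esub> g \<otimes>\<^bsub>P\<^esub> inv\<^bsub>P\<^esub> transversal (c #>\<^bsub>P\<^esub> g) \<in> H"
proof (rule G.coset_join1[OF _ _ subgroup_H])
  let ?d = "c #>\<^bsub>P\<^esub> g"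
  have d: "?d \<in> C" using assms by (rule coset_act_closed)
  note t = transversal[OF assms(1)] transversal[OF d]
  have "H #>\<^bsub>P\<^esub> (transversal c \<otimes>\<^bsub>P\<^esub> g) = H #>\<^bsub>P\<^esub> transversal ?d"
    using t assms by (simp flip: coset_act_mult add: H_in_cosets)
  then show "H #>\<^bsub>P\<^esub> (transversal c \<otimes>\<^bsub>P\<^esub> g \<otimes>\<^bsub>P\<^esub> inv\<^bsub>P\<^esub> transversal ?d) = H"
    using t assms by (intro G.coset_mult_inv2) (auto simp: subgroup.subset[OF subgroup_H])
  show "transversal c \<otimes>\<^bsub>P\<^esub> g \<otimes>\<^bsub>P\<^esub> inv\<^bsub>P\<^esub> transversal ?d \<in> carrier P"
    using t assms by simp
qed

abbreviation "Hgrp \<equiv> P\<lparr>carrier := H\<rparr>"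
abbreviation "basis \<equiv> C - {H}"

sublocale K: free_product_groups Hgrp "free_group basis"
  by (simp add: free_product_groups_def group_free_group G.subgroup_imp_group subgroup_H)

abbreviation "FP \<equiv> free_product Hgrp (free_group basis)"

sublocale KG: group FP by (rule K.group_free_product)

lemma inl_closed: "h \<in> H \<Longrightarrow> K.inl h \<in> carrier FP"
  using hom_in_carrier[OF K.inl_hom] by simp

lemma inl_mult: "h \<in> H \<Longrightarrow> k \<in> H \<Longrightarrow> K.inl (h \<otimes>\<^bsub>P\<^esub> k) = K.inl h \<otimes>\<^bsub>FP\<^esub> K.inl k"
  using hom_mult[OF K.inl_hom, of h k] by simp

lemma inl_one: "K.inl \<one>\<^bsub>P\<^esub> = \<one>\<^bsub>FP\<^esub>"
  using hom_one[OF K.inl_hom] K.G.group_axioms KG.group_axioms by simp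

text \<open>These are the elements \<open>x_c\<close> of the free factor. Setting \<open>x_H\<close>
  to the identity is what lowers the rank from the number of cosets by one.\<close>

definition "base c = (if c = H then \<one>\<^bsub>FP\<^esub> else K.inr [(c, True)])"

lemma base_closed: "c \<in> C \<Longrightarrow> base c \<in> carrier FP"
  using hom_in_carrier[OF K.inr_hom]
  by (auto simp: base_def carrier_free_group freely_reduced_Cons)

text \<open>The representation of the action groupoid in the free product whose restriction to the vertex
  group at \<open>H\<close> is the canonical embedding and which sends the arrow from \<open>H\<close> to \<open>c\<close> given by the
  transversal to the free generator \<open>c\<close>.\<close>

definition product_arrow :: "'s word set set \<Rightarrow> 's word set \<Rightarrow> _" where
  "product_arrow c g =
     inv\<^bsub>FP\<^esub> base c \<otimes>\<^bsub>FP\<^esub>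
     K.inl (transversal c \<otimes>\<^bsub>P\<^esub> g \<otimes>\<^bsub>P\<^esub> inv\<^bsub>P\<^esub> transversal (c #>\<^bsub>P\<^esub> g)) \<otimes>\<^bsub>FP\<^esub>
     base (c #>\<^bsub>P\<^esub> g)"

lemma product_arrow_closed: "c \<in> C \<Longrightarrow> g \<in> carrier P \<Longrightarrow> product_arrow c g \<in> carrier FP"
  by (simp add: product_arrow_def base_closed inl_closed schreier_element coset_act_closed)

text \<open>At the intermediate coset two cancellations take place: the transversal elements cancel
  inside \<open>H\<close>, and the two occurrences of \<open>base ?d\<close> cancel in the free
  product.\<close>

lemma product_arrow_mult:
  assumes c: "c \<in> C" and g: "g \<in> carrier P" and h: "h \<in> carrier P"
  shows "product_arrow c (g \<otimes>\<^bsub>P\<^esub> h) = product_arrow c g \<otimes>\<^bsub>FP\<^esub> product_arrow (c #>\<^bsub>P\<^esub> g) h"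
proof -
  let ?d = "c #>\<^bsub>P\<^esub> g"
  let ?e = "?d #>\<^bsub>P\<^esub> h"
  let ?a = "transversal c \<otimes>\<^bsub>P\<^esub> g \<otimes>\<^bsub>P\<^esub> inv\<^bsub>P\<^esub> transversal ?d"
  let ?b = "transversal ?d \<otimes>\<^bsub>P\<^esub> h \<otimes>\<^bsub>P\<^esub> inv\<^bsub>P\<^esub> transversal ?e"
  have d: "?d \<in> C" and e: "?e \<in> C" using c g h by (auto intro: coset_act_closed)
  note t = transversal(1)[OF c] transversal(1)[OF d] transversal(1)[OF e]
  have ce: "c #>\<^bsub>P\<^esub> (g \<otimes>\<^bsub>P\<^esub> h) = ?e" using assms by (simp add: coset_act_mult)
  have ab: "transversal c \<otimes>\<^bsub>P\<^esub> (g \<otimes>\<^bsub>P\<^esub> h) \<otimes>\<^bsub>P\<^esub> inv\<^bsub>P\<^esub> transversal ?e = ?a \<otimes>\<^bsub>P\<^esub> ?b"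
    using t g h by (simp add: G.m_assoc G.mult_inv_cancel_left)
  have cl: "K.inl ?a \<in> carrier FP" "K.inl ?b \<in> carrier FP"
    "base c \<in> carrier FP" "base ?d \<in> carrier FP" "base ?e \<in> carrier FP"
    using assms d e by (simp_all add: inl_closed schreier_element base_closed)
  have "product_arrow c g \<otimes>\<^bsub>FP\<^esub> product_arrow ?d h =
      inv\<^bsub>FP\<^esub> base c \<otimes>\<^bsub>FP\<^esub> (K.inl ?a \<otimes>\<^bsub>FP\<^esub> K.inl ?b) \<otimes>\<^bsub>FP\<^esub> base ?e"
    unfolding product_arrow_def using cl by (simp add: KG.m_assoc KG.mult_inv_cancel_left)
  also have "\<dots> = product_arrow c (g \<otimes>\<^bsub>P\<^esub> h)"
    using assms d unfolding product_arrow_def ce ab by (simp add: inl_mult schreier_element)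
  finally show ?thesis by (rule sym)
qed

lemma product_arrow_one: "c \<in> C \<Longrightarrow> product_arrow c \<one>\<^bsub>P\<^esub> = \<one>\<^bsub>FP\<^esub>"
  by (simp add: product_arrow_def transversal inl_one base_closed)

lemma product_arrow_at_subgroup: "h \<in> H \<Longrightarrow> product_arrow H h = K.inl h"
  using subgroup.mem_carrier[OF subgroup_H]
  by (simp add: product_arrow_def subgroup_act base_def inl_closed)

text \<open>The Schreier element of this arrow is the identity, so only the free generator
  remains.\<close>

lemma product_arrow_transversal: "c \<in> C \<Longrightarrow> product_arrow H (transversal c) = base c"
  using base_closed by (simp add: product_arrow_def transversal inl_one base_def[of H])

definition "gen_image = (\<lambda>(s, c). product_arrow c (cls [(s, True)]))"

lemma gen_image_in: "gen_image \<in> S \<times> C \<rightarrow> carrier FP"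
  by (auto simp: gen_image_def intro: product_arrow_closed)

text \<open>The lift of \<open>w\<close> follows consecutive arrows of the action groupoid, so
  multiplicativity of \<open>product_arrow\<close> collects the letters one by one.\<close>

lemma word_eval_lift:
  "w \<in> words S \<Longrightarrow> c \<in> C \<Longrightarrow> KG.word_eval gen_image (lift c w) = product_arrow c (cls w)"
proof (induction w arbitrary: c)
  case (Cons x w)
  then have x: "fst x \<in> S" and w: "w \<in> words S" and c: "c \<in> C" by simp_all
  let ?d = "act c x"
  have d: "?d \<in> C" using x c by (simp add: coset_act_cls)
  have "KG.letter_eval gen_image ((fst x, if snd x then c else ?d), snd x) = product_arrow c (cls [x])"
  proof (cases "snd x")
    case False
    then have x_eq: "[(fst x, True)] = inv_word [x]" by (cases x) simp
    \<comment> \<open>A negative letter from \<open>c\<close> to \<open>?d\<close> lifts to the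
      inverse of a generator at \<open>?d\<close>, so the arrow of that generator has to be the
      inverse of the arrow of \<open>x\<close> at \<open>c\<close>.\<close>
    have "product_arrow c (cls [x]) \<otimes>\<^bsub>FP\<^esub> product_arrow ?d (cls (inv_word [x])) = product_arrow c (cls [x] \<otimes>\<^bsub>P\<^esub> cls (inv_word [x]))"
      using x c by (subst product_arrow_mult) (simp_all add: inv_letter_def)
    also have "\<dots> = \<one>\<^bsub>FP\<^esub>"
      using x c by (simp add: product_arrow_one word_class_inv del: inv_word_simps)
    finally have "inv\<^bsub>FP\<^esub> product_arrow ?d (cls (inv_word [x])) = product_arrow c (cls [x])"
      using x c d by (intro KG.inv_equality) (auto simp: product_arrow_closed inv_letter_def)
    then show ?thesis using False x_eq by (simp add: KG.letter_eval_def gen_image_def del: inv_word_simps)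
  next
    case True
    then show ?thesis by (cases x) (simp add: KG.letter_eval_def gen_image_def)
  qed
  then have "KG.word_eval gen_image (lift c (x # w)) = product_arrow c (cls [x]) \<otimes>\<^bsub>FP\<^esub> product_arrow ?d (cls w)"
    using Cons.IH[OF w d] by (simp add: KG.word_eval_Cons)
  also have "\<dots> = product_arrow c (cls (x # w))"
    using x w c by (subst product_arrow_mult[symmetric]) simp_all
  finally show ?case .
qed (simp add: product_arrow_one)

text \<open>Both homomorphisms come from universal properties, and both composites are shown to be
  the identity on generators.\<close>

theorem lifted_presentation_iso: "L.P \<cong> FP"
proof -
  \<comment> \<open>The lift of a relator goes to the arrow of the identity element at its sheet,
    hence to the identity.\<close>
  have "KG.word_eval gen_image r = \<one>\<^bsub>FP\<^esub>" if "r \<in> lifted_relators" for r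
    using that relators
    by (auto simp: lifted_relators_def word_eval_lift word_class_relator product_arrow_one)
  then obtain \<phi> where \<phi>: "\<phi> \<in> hom L.P FP"
    and \<phi>_cls: "\<And>w. w \<in> words (S \<times> C) \<Longrightarrow> \<phi> (L.cls w) = KG.word_eval gen_image w"
    using L.word_class_universal[OF KG.group_axioms gen_image_in] by metis
  have \<phi>_arrow: "\<phi> (arrow c g) = product_arrow c g" if "c \<in> C" "g \<in> carrier P" for c g
  proof -
    obtain w where "w \<in> words S" "g = cls w" using \<open>g \<in> carrier P\<close> by (rule word_class_surj)
    with \<open>c \<in> C\<close> show ?thesis by (simp add: arrow_cls \<phi>_cls lift_in_words word_eval_lift)
  qed
  have H_carrier: "h \<in> carrier P" if "h \<in> H" for h
    using that by (rule subgroup.mem_carrier[OF subgroup_H])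
  have arrow_H: "arrow H \<in> hom Hgrp L.P"
    by (rule homI) (simp_all add: H_carrier H_in_cosets arrow_closed arrow_mult subgroup_act)
  have arrow_B: "(\<lambda>b. arrow H (transversal b)) \<in> basis \<rightarrow> carrier L.P"
    by (auto simp: arrow_closed H_in_cosets transversal)
  obtain \<psi> where \<psi>: "\<psi> \<in> hom FP L.P"
    and \<psi>_inl: "\<And>h. h \<in> carrier Hgrp \<Longrightarrow> \<psi> (K.inl h) = arrow H h"
    and \<psi>_inr: "\<And>w. w \<in> carrier (free_group basis) \<Longrightarrow>
      \<psi> (K.inr w) = LG.word_eval (\<lambda>b. arrow H (transversal b)) w"
    using K.free_product_universal[OF LG.group_axioms arrow_H LG.word_eval_hom[OF arrow_B]]
    by metis
  interpret \<phi>: group_hom L.P FP \<phi>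
    using \<phi> by (simp add: group_hom_def group_hom_axioms_def LG.group_axioms KG.group_axioms)
  interpret \<psi>: group_hom FP L.P \<psi>
    using \<psi> by (simp add: group_hom_def group_hom_axioms_def LG.group_axioms KG.group_axioms)
  have gen_in: "[(b, True)] \<in> carrier (free_group basis)" if "b \<in> basis" for b
    using that by (simp add: carrier_free_group freely_reduced_Cons)
  have \<psi>_base: "\<psi> (base c) = arrow H (transversal c)" if "c \<in> C" for c
    using that gen_in[of c]
    by (auto simp: base_def \<psi>_inr LG.word_eval_singleton arrow_one H_in_cosets arrow_closed transversal)
  have \<psi>_arrow: "\<psi> (product_arrow c g) = arrow c g" if c: "c \<in> C" and g: "g \<in> carrier P" for c g
  proof -
    let ?d = "c #>\<^bsub>P\<^esub> g"
    let ?h = "transversal c \<otimes>\<^bsub>P\<^esub> g \<otimes>\<^bsub>P\<^esub> inv\<^bsub>P\<^esub> transversal ?d"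
    have d: "?d \<in> C" using c g by (rule coset_act_closed)
    have h: "?h \<in> H" using c g by (rule schreier_element)
    note t = transversal[OF c] transversal[OF d]
    \<comment> \<open>The arrow from \<open>H\<close> to \<open>?d\<close> given by
      \<open>transversal c\<close> times \<open>g\<close> is factored in two ways: through
      \<open>H\<close> by \<open>?h\<close> and then \<open>transversal ?d\<close>, and through
      \<open>c\<close> by \<open>transversal c\<close> and then \<open>g\<close>.\<close>
    have "arrow H ?h \<otimes>\<^bsub>L.P\<^esub> arrow H (transversal ?d) = arrow H (?h \<otimes>\<^bsub>P\<^esub> transversal ?d)"
      using h t by (simp add: arrow_mult H_in_cosets H_carrier subgroup_act)
    also have "?h \<otimes>\<^bsub>P\<^esub> transversal ?d = transversal c \<otimes>\<^bsub>P\<^esub> g"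
      using t g by (simp add: G.m_assoc)
    also have "arrow H (transversal c \<otimes>\<^bsub>P\<^esub> g) = arrow H (transversal c) \<otimes>\<^bsub>L.P\<^esub> arrow c g"
      using t g by (simp add: arrow_mult H_in_cosets)
    finally have *: "arrow H ?h \<otimes>\<^bsub>L.P\<^esub> arrow H (transversal ?d) = arrow H (transversal c) \<otimes>\<^bsub>L.P\<^esub> arrow c g" .
    have "\<psi> (product_arrow c g) =
        inv\<^bsub>L.P\<^esub> arrow H (transversal c) \<otimes>\<^bsub>L.P\<^esub> arrow H ?h \<otimes>\<^bsub>L.P\<^esub> arrow H (transversal ?d)"
      using c d h by (simp add: product_arrow_def base_closed inl_closed \<psi>_base \<psi>_inl)
    also have "\<dots> = inv\<^bsub>L.P\<^esub> arrow H (transversal c) \<otimes>\<^bsub>L.P\<^esub> (arrow H (transversal c) \<otimes>\<^bsub>L.P\<^esub> arrow c g)"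
      using t h by (simp add: LG.m_assoc * arrow_closed H_in_cosets H_carrier)
    also have "\<dots> = arrow c g"
      using t c g by (simp add: LG.m_assoc[symmetric] arrow_closed H_in_cosets)
    finally show ?thesis .
  qed
  have "\<psi> (\<phi> a) = a" if "a \<in> carrier L.P" for a
  proof -
    \<comment> \<open>Each generator of \<open>L.P\<close> is itself an arrow, and the composite
      fixes arrows.\<close>
    have gen: "(\<psi> \<circ> \<phi>) (L.cls [(z, True)]) = id (L.cls [(z, True)])" if "z \<in> S \<times> C" for z
    proof (cases z)
      case (Pair s c)
      with that have "s \<in> S" "c \<in> C" by simp_all
      then have "L.cls [(z, True)] = arrow c (cls [(s, True)])"
        using Pair by (simp add: arrow_cls)
      with \<open>s \<in> S\<close> \<open>c \<in> C\<close> show ?thesis by (simp add: \<phi>_arrow \<psi>_arrow)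
    qed
    have "(\<psi> \<circ> \<phi>) a = id a"
      using Group.hom_compose[OF \<phi> \<psi>]
      by (rule L.hom_presented_eqI[where \<phi> = "\<psi> \<circ> \<phi>" and \<psi> = id, OF LG.group_axioms _ _ gen that]) (simp_all add: hom_def)
    then show ?thesis by simp
  qed
  moreover have "\<phi> (\<psi> a) = a" if "a \<in> carrier FP" for a
  proof -
    have id_FP: "id \<in> hom FP FP" by (simp add: hom_def)
    have comp: "\<phi> \<circ> \<psi> \<in> hom FP FP" using \<psi> \<phi> by (rule Group.hom_compose)
    have inl: "(\<phi> \<circ> \<psi>) (K.inl h) = id (K.inl h)" if "h \<in> carrier Hgrp" for h
      using that by (simp add: \<psi>_inl \<phi>_arrow H_in_cosets H_carrier product_arrow_at_subgroup)
    have inr: "(\<phi> \<circ> \<psi>) (K.inr w) = id (K.inr w)" if "w \<in> carrier (free_group basis)" for w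
    proof -
      \<comment> \<open>On the free factor only the generators have to be compared; they are the
        images of the transversal arrows.\<close>
      have "(\<phi> \<circ> \<psi> \<circ> K.inr) w = K.inr w"
      proof (rule hom_free_group_eqI[OF KG.group_axioms _ K.inr_hom _ that])
        show "\<phi> \<circ> \<psi> \<circ> K.inr \<in> hom (free_group basis) FP"
          using K.inr_hom comp by (rule Group.hom_compose)
        fix b assume b: "b \<in> basis"
        then have "K.inr [(b, True)] = base b" by (simp add: base_def)
        with b show "(\<phi> \<circ> \<psi> \<circ> K.inr) [(b, True)] = K.inr [(b, True)]"
          by (simp add: \<psi>_base \<phi>_arrow H_in_cosets transversal product_arrow_transversal)
      qed
      then show ?thesis by simp
    qed
    have "(\<phi> \<circ> \<psi>) a = id a"
      by (rule K.hom_free_product_eqI[OF KG.group_axioms comp id_FP inl inr that])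
    then show ?thesis by simp
  qed
  ultimately have "bij_betw \<phi> (carrier L.P) (carrier FP)"
    by (intro bij_betw_byWitness[where f' = \<psi>]) auto
  then have "\<phi> \<in> iso L.P FP" using \<phi> by (simp add: iso_def)
  then show ?thesis by (auto simp: is_iso_def)
qed

end


section \<open>Free product length\<close>

text \<open>Replacing letters by their factors turns the syllables of a reduced word into maximal
  constant runs, which \<open>remdups_adj\<close> counts.\<close>

definition block :: "'a set set \<Rightarrow> 'a \<Rightarrow> 'a set" where
  "block \<P> s = (THE P. P \<in> \<P> \<and> s \<in> P)"

lemma block_eq:
  assumes "disjoint \<P>" "P \<in> \<P>" "s \<in> P"
  shows "block \<P> s = P"
  unfolding block_def using assms by (intro the_equality) (auto simp: disjoint_def)

text \<open>A syllable contributes a single run; the condition on \<open>ys\<close> keeps this run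
  from merging with the next one.\<close>

lemma remdups_adj_constant_append:
  assumes "xs \<noteq> []" "set xs \<subseteq> {P}" "ys = [] \<or> hd ys \<noteq> P"
  shows "remdups_adj (xs @ ys) = P # remdups_adj ys"
  using assms
proof (induction xs)
  case (Cons x xs)
  then show ?case
  proof (cases xs)
    case Nil
    with Cons show ?thesis by (cases ys) auto
  qed auto
qed simp

abbreviation normal_form_with where
  "normal_form_with \<P> Ps gs \<equiv>
     list_all2 (\<lambda>P g. P \<in> \<P> \<and> g \<in> carrier (free_group P) \<and> g \<noteq> \<one>\<^bsub>free_group P\<^esub>) Ps gs \<and>
     successively (\<noteq>) Ps"

text \<open>Neighbouring syllables use disjoint sets of generators, so nothing cancels where they
  meet: the product is the concatenation, and the runs of blocks recover the sequence of
  factors.\<close>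

lemma normal_form_concat:
  assumes "disjoint \<P>" "normal_form_with \<P> Ps gs"
  shows "freely_reduced (concat gs)"
    and "foldr (monoid.mult (free_group X)) gs \<one>\<^bsub>free_group X\<^esub> = concat gs"
    and "remdups_adj (map (block \<P> \<circ> fst) (concat gs)) = Ps"
proof -
  \<comment> \<open>The clauses on \<open>Ps = []\<close> and \<open>hd Ps\<close> strengthen the
    induction: they locate the factor of the first letter of the remaining word, which excludes both
    cancellation and merging of runs.\<close>
  have "freely_reduced (concat gs) \<and>
      foldr (monoid.mult (free_group X)) gs \<one>\<^bsub>free_group X\<^esub> = concat gs \<and>
      (Ps = [] \<longrightarrow> concat gs = []) \<and>
      (Ps \<noteq> [] \<longrightarrow> concat gs \<noteq> [] \<and> hd Ps \<in> \<P> \<and> fst (hd (concat gs)) \<in> hd Ps) \<and>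
      remdups_adj (map (block \<P> \<circ> fst) (concat gs)) = Ps"
    using conjunct1[OF assms(2)] conjunct2[OF assms(2)]
  proof (induction rule: list_all2_induct)
    case (Cons P Ps g gs)
    define w where "w = concat gs"
    have P: "P \<in> \<P>" and g: "g \<in> words P" "freely_reduced g" "g \<noteq> []"
      using Cons.hyps(1) by (simp_all add: carrier_free_group)
    have succ: "successively (\<noteq>) Ps" and ne: "Ps \<noteq> [] \<Longrightarrow> hd Ps \<noteq> P"
      using Cons.prems by (auto simp: successively_Cons)
    note IH = Cons.IH[OF succ]
    have IH: "freely_reduced w" "foldr (monoid.mult (free_group X)) gs \<one>\<^bsub>free_group X\<^esub> = w"
        "Ps = [] \<Longrightarrow> w = []" "Ps \<noteq> [] \<Longrightarrow> hd Ps \<in> \<P>"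
        "Ps \<noteq> [] \<Longrightarrow> fst (hd w) \<in> hd Ps"
        "remdups_adj (map (block \<P> \<circ> fst) w) = Ps"
      using IH unfolding w_def by blast+
    have P_letters: "fst x \<in> P" if "x \<in> set g" for x
      using g(1) that by (auto simp: words_iff)
    have differ: "fst (hd w) \<notin> P" if "w \<noteq> []"
    proof -
      have "Ps \<noteq> []" using that IH(3) by blast
      with assms(1) P ne IH(4,5) show ?thesis by (metis block_eq)
    qed
    have "hd w \<noteq> inv_letter (last g)" if "w \<noteq> []"
      using differ[OF that] P_letters[of "last g"] g(3) by (auto simp: inv_letter_def)
    then have red: "freely_reduced (g @ w)"
      using g(2) IH(1) by (auto simp: freely_reduced_def successively_append_iff)
    have hd_block: "hd (map (block \<P> \<circ> fst) w) \<noteq> P" if "w \<noteq> []"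
    proof -
      have "Ps \<noteq> []" using that IH(3) by blast
      then have "block \<P> (fst (hd w)) = hd Ps" using IH(4,5) by (intro block_eq[OF assms(1)]) auto
      then show ?thesis using that ne[OF \<open>Ps \<noteq> []\<close>] by (simp add: hd_map)
    qed
    have "set (map (block \<P> \<circ> fst) g) \<subseteq> {P}"
      using P_letters block_eq[OF assms(1) P] by auto
    then have "remdups_adj (map (block \<P> \<circ> fst) g @ map (block \<P> \<circ> fst) w) =
        P # remdups_adj (map (block \<P> \<circ> fst) w)"
      using g(3) hd_block by (intro remdups_adj_constant_append) auto
    then have blocks: "remdups_adj (map (block \<P> \<circ> fst) (concat (g # gs))) = P # Ps"
      by (simp only: IH(6) concat.simps map_append flip: w_def)
    have prod: "foldr (monoid.mult (free_group X)) (g # gs) \<one>\<^bsub>free_group X\<^esub> = concat (g # gs)"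
      using IH(2) red by (simp del: one_free_group flip: w_def)
    have "fst (hd (concat (g # gs))) \<in> P" "concat (g # gs) \<noteq> []" "freely_reduced (concat (g # gs))"
      using P_letters[of "hd g"] g(3) red by (simp_all flip: w_def)
    with P blocks prod show ?case by (metis list.sel(1) list.distinct(1))
  qed auto
  then show "freely_reduced (concat gs)"
    and "foldr (monoid.mult (free_group X)) gs \<one>\<^bsub>free_group X\<^esub> = concat gs"
    and "remdups_adj (map (block \<P> \<circ> fst) (concat gs)) = Ps"
    by blast+
qed

text \<open>Syllables are built from the right: a new first letter joins the first syllable if it
  lies in the same factor and otherwise starts a syllable of its own.\<close>

lemma normal_form_exists:
  assumes "freely_reduced w" "w \<in> words (\<Union> \<P>)"
  shows "\<exists>Ps gs. normal_form_with \<P> Ps gs \<and> concat gs = w"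
  using assms
proof (induction w)
  case Nil
  then show ?case by (intro exI[of _ "[]"]) simp
next
  case (Cons x w)
  then obtain Ps gs where nf: "normal_form_with \<P> Ps gs" and w: "concat gs = w"
    by (auto simp: freely_reduced_Cons)
  obtain P where P: "P \<in> \<P>" "fst x \<in> P" using Cons.prems by auto
  show ?case
  proof (cases "Ps \<noteq> [] \<and> hd Ps = P")
    case True
    then obtain Qs g hs where eq: "Ps = P # Qs" "gs = g # hs"
      using nf by (cases Ps; cases gs) auto
    with nf w Cons.prems P have "normal_form_with \<P> (P # Qs) ((x # g) # hs)"
      by (auto simp: carrier_free_group freely_reduced_Cons)
    with eq w show ?thesis by (intro exI[of _ "P # Qs"] exI[of _ "(x # g) # hs"]) simp
  next
    case False
    with nf P have "normal_form_with \<P> (P # Ps) ([x] # gs)"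
      by (auto simp: carrier_free_group freely_reduced_Cons successively_Cons)
    with w show ?thesis by (intro exI[of _ "P # Ps"] exI[of _ "[x] # gs"]) simp
  qed
qed

text \<open>Every normal form of \<open>w\<close> concatenates to \<open>w\<close> and has as many
  syllables as \<open>w\<close> has runs. This gives the uniqueness that the definite description
  requires.\<close>

lemma free_product_length_eq:
  assumes "disjoint \<P>" "freely_reduced w" "w \<in> words (\<Union> \<P>)"
  shows "free_product_length \<P> w = length (remdups_adj (map (block \<P> \<circ> fst) w))"
  unfolding free_product_length_def Let_def free_product_normal_form_def
proof (rule the_equality)
  obtain Ps gs where nf: "normal_form_with \<P> Ps gs" and w: "concat gs = w"
    using normal_form_exists[OF assms(2,3)] by blast
  have "length gs = length (remdups_adj (map (block \<P> \<circ> fst) w))"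
    using nf normal_form_concat(3)[OF assms(1) nf] w by (auto dest: list_all2_lengthD)
  then show "\<exists>gs. (\<exists>Ps. normal_form_with \<P> Ps gs) \<and>
      foldr (monoid.mult (free_group (\<Union> \<P>))) gs \<one>\<^bsub>free_group (\<Union> \<P>)\<^esub> = w \<and>
      length gs = length (remdups_adj (map (block \<P> \<circ> fst) w))"
    using nf normal_form_concat(2)[OF assms(1) nf] w by blast
next
  fix n assume "\<exists>gs. (\<exists>Ps. normal_form_with \<P> Ps gs) \<and>
      foldr (monoid.mult (free_group (\<Union> \<P>))) gs \<one>\<^bsub>free_group (\<Union> \<P>)\<^esub> = w \<and> length gs = n"
  then obtain gs Ps where nf: "normal_form_with \<P> Ps gs"
    and w: "foldr (monoid.mult (free_group (\<Union> \<P>))) gs \<one>\<^bsub>free_group (\<Union> \<P>)\<^esub> = w" and n: "length gs = n"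
    by blast
  have "concat gs = w" using normal_form_concat(2)[OF assms(1) nf] w by metis
  then show "n = length (remdups_adj (map (block \<P> \<circ> fst) w))"
    using nf normal_form_concat(3)[OF assms(1) nf] n by (auto dest: list_all2_lengthD)
qed

lemma map_fst_in_words: "w \<in> words (A \<times> C) \<Longrightarrow> map (map_prod fst id) w \<in> words A"
  by (induction w) auto

text \<open>For nonempty \<open>C\<close> the map from \<open>P\<close> to
  \<open>P \<times> C\<close> is injective, so projection preserves the runs of blocks. A nonempty
  \<open>w\<close> supplies an element of \<open>C\<close>, which is why the empty word is treated
  apart.\<close>

lemma free_product_length_times:
  assumes "disjoint \<P>" and w: "w \<in> words (\<Union> \<P> \<times> C)"
    and red: "freely_reduced w" "freely_reduced (map (map_prod fst id) w)"
  shows "free_product_length ((\<lambda>P. P \<times> C) ` \<P>) w = free_product_length \<P> (map (map_prod fst id) w)"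
proof (cases "w = []")
  case True
  have "disjoint ((\<lambda>P. P \<times> C) ` \<P>)" using assms(1) by (auto simp: disjoint_def)
  with True assms(1) show ?thesis by (simp add: free_product_length_eq)
next
  case False
  then have C: "C \<noteq> {}" using w by (cases w) auto
  have disj: "disjoint ((\<lambda>P. P \<times> C) ` \<P>)" using assms(1) by (auto simp: disjoint_def)
  have union: "\<Union> ((\<lambda>P. P \<times> C) ` \<P>) = \<Union> \<P> \<times> C" by auto
  have proj: "map (map_prod fst id) w \<in> words (\<Union> \<P>)"
    using w by (rule map_fst_in_words)
  have "block ((\<lambda>P. P \<times> C) ` \<P>) (fst x) = block \<P> (fst (fst x)) \<times> C" if "x \<in> set w" for x
  proof -
    have "fst x \<in> \<Union> \<P> \<times> C" using w that unfolding words_iff by blast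
    then obtain P where P: "P \<in> \<P>" "fst (fst x) \<in> P" "snd (fst x) \<in> C"
      by (cases "fst x") auto
    then have "block ((\<lambda>P. P \<times> C) ` \<P>) (fst x) = P \<times> C"
      using disj by (intro block_eq) (auto simp: mem_Times_iff)
    with P block_eq[OF assms(1)] show ?thesis by simp
  qed
  then have "map (block ((\<lambda>P. P \<times> C) ` \<P>) \<circ> fst) w =
      map (\<lambda>P. P \<times> C) (map (block \<P> \<circ> fst) (map (map_prod fst id) w))"
    by simp
  moreover have inj: "inj (\<lambda>P. P \<times> C)" using C by (auto simp: inj_def times_eq_iff)
  ultimately have "length (remdups_adj (map (block ((\<lambda>P. P \<times> C) ` \<P>) \<circ> fst) w)) =
      length (remdups_adj (map (block \<P> \<circ> fst) (map (map_prod fst id) w)))"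
    by (simp only: remdups_adj_map_injective[OF inj] length_map)
  then show ?thesis
    using assms disj union proj by (simp add: free_product_length_eq)
qed


section \<open>Paths in labelled graphs\<close>

lemma path_label_simps [simp]:
  "path_label \<Gamma> [] = []"
  "path_label \<Gamma> (d # ds) = (label \<Gamma> (fst d), snd d) # path_label \<Gamma> ds"
  "path_label \<Gamma> (ds @ es) = path_label \<Gamma> ds @ path_label \<Gamma> es"
  by (simp_all add: path_label_def map_prod_def split_beta)

lemma path_label_eq_Nil [simp]: "path_label \<Gamma> ds = [] \<longleftrightarrow> ds = []"
  by (simp add: path_label_def)

lemma not_distinct_map_decomp:
  "\<not> distinct (map f xs) \<Longrightarrow> \<exists>as a bs b cs. xs = as @ a # bs @ b # cs \<and> f a = f b"
proof (induction xs)
  case (Cons x xs)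
  show ?case
  proof (cases "f x \<in> f ` set xs")
    case True
    then obtain y where "y \<in> set xs" "f x = f y" by blast
    then show ?thesis by (metis append_Nil split_list)
  next
    case False
    with Cons show ?thesis by (metis append_Cons distinct.simps(2) list.set_map list.simps(9))
  qed
qed simp

lemma distinct_fst_immersed: "distinct (map fst ds) \<Longrightarrow> successively (\<lambda>d d'. d' \<noteq> inv_letter d) ds"
  by (induction ds rule: induct_list012) (auto simp: inv_letter_def)

lemma terminal_inv_letter [simp]: "terminal \<Gamma> (inv_letter d) = initial \<Gamma> d"
  and initial_inv_letter [simp]: "initial \<Gamma> (inv_letter d) = terminal \<Gamma> d"
  by (simp_all add: initial_def terminal_def inv_letter_def)

locale labelled_graph =
  fixes S :: "'s set" and \<Gamma> :: "('v, 'e, 's) labelled_graph"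
  assumes labelled: "labelled_by S \<Gamma>"
begin

lemma label_in: "e \<in> arcs \<Gamma> \<Longrightarrow> label \<Gamma> e \<in> S"
  using labelled by (simp add: labelled_by_def)

lemma ends_in_verts: "e \<in> arcs \<Gamma> \<Longrightarrow> tail \<Gamma> e \<in> verts \<Gamma>" "e \<in> arcs \<Gamma> \<Longrightarrow> head \<Gamma> e \<in> verts \<Gamma>"
  using labelled
  by (auto simp: labelled_by_def wf_digraph_def pre_digraph.truncate_def)

lemma initial_in_verts: "fst d \<in> arcs \<Gamma> \<Longrightarrow> initial \<Gamma> d \<in> verts \<Gamma>"
  by (simp add: initial_def ends_in_verts)

lemma edge_path_initial: "edge_path \<Gamma> u ds v \<Longrightarrow> u \<in> verts \<Gamma>"
  by (cases ds) (auto simp: initial_in_verts)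

lemma edge_path_append:
  "edge_path \<Gamma> u (ds @ es) v \<longleftrightarrow> (\<exists>w. edge_path \<Gamma> u ds w \<and> edge_path \<Gamma> w es v)"
  by (induction ds arbitrary: u) (auto dest: edge_path_initial)

lemma path_label_in_words: "edge_path \<Gamma> u ds v \<Longrightarrow> path_label \<Gamma> ds \<in> words S"
  by (induction ds arbitrary: u) (auto simp: label_in)

lemma edge_path_between:
  assumes "edge_path \<Gamma> u (as @ a # bs @ b # cs) v"
  shows "edge_path \<Gamma> u as (initial \<Gamma> a)" "edge_path \<Gamma> (initial \<Gamma> a) (a # bs) (initial \<Gamma> b)"
    "edge_path \<Gamma> (initial \<Gamma> b) (b # cs) v"
  using assms by (auto simp: edge_path_append)

lemma immersed_sublist:
  assumes "edge_path \<Gamma> u ds v" "successively (\<lambda>d d'. d' \<noteq> inv_letter d) ds" "sublist q ds"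
  shows "\<exists>w. immersed_path \<Gamma> w q"
proof -
  obtain ps ss where "ds = ps @ q @ ss" using assms(3) by (auto simp: sublist_def)
  then have "\<exists>w x. edge_path \<Gamma> w q x" "successively (\<lambda>d d'. d' \<noteq> inv_letter d) q"
    using assms(1,2) by (auto simp: edge_path_append successively_append_iff)
  then show ?thesis unfolding immersed_path_def by blast
qed

lemma simple_closed_path_immersed:
  "simple_closed_path \<Gamma> u ds \<Longrightarrow> successively (\<lambda>d d'. d' \<noteq> inv_letter d) ds"
  by (simp add: simple_closed_path_def distinct_fst_immersed)

abbreviation "graph_relators \<equiv> {path_label \<Gamma> ds | u ds. simple_closed_path \<Gamma> u ds}"

sublocale presentation S graph_relators
  by unfold_locales (auto simp: simple_closed_path_def path_label_in_words)

lemma graph_group_eq: "graph_group S \<Gamma> = P"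
  by (simp add: graph_group_def)

text \<open>Induction on length. A repeated vertex cuts off a shorter closed path and leaves another
  one. With distinct vertices, a repeated edge can only be an immediate backtrack, which cancels
  freely. Otherwise the path is simple and its label is a relator.\<close>

lemma closed_path_trivial: "edge_path \<Gamma> u ds u \<Longrightarrow> cls (path_label \<Gamma> ds) = \<one>\<^bsub>P\<^esub>"
proof (induction ds arbitrary: u rule: length_induct)
  case (1 ds)
  interpret G: group P by (rule group_presented)
  show ?case
  proof (cases "distinct (map (initial \<Gamma>) ds)")
    case False
    then obtain as a bs b cs where ds: "ds = as @ a # bs @ b # cs" and eq: "initial \<Gamma> a = initial \<Gamma> b"
      using not_distinct_map_decomp by blast
    note paths = edge_path_between[OF 1(2)[unfolded ds]]
    have outer: "edge_path \<Gamma> u (as @ b # cs) u"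
      using paths eq by (auto simp: edge_path_append)
    have "cls (path_label \<Gamma> (a # bs)) = \<one>\<^bsub>P\<^esub>" "cls (path_label \<Gamma> (as @ b # cs)) = \<one>\<^bsub>P\<^esub>"
      using 1(1)[rule_format, of "a # bs"] 1(1)[rule_format, of "as @ b # cs"] paths(2) outer eq
      by (simp_all only: ds) simp_all
    moreover have "cls (path_label \<Gamma> ds) =
        cls (path_label \<Gamma> as) \<otimes>\<^bsub>P\<^esub> (cls (path_label \<Gamma> (a # bs)) \<otimes>\<^bsub>P\<^esub> cls (path_label \<Gamma> (b # cs)))"
      using paths[THEN path_label_in_words] by (simp add: ds)
    ultimately show ?thesis
      using paths[THEN path_label_in_words] by simp
  next
    case initial: True
    show ?thesis
    proof (cases "distinct (map fst ds)")
      case True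
      with initial 1(2) have "simple_closed_path \<Gamma> u ds" by (simp add: simple_closed_path_def)
      then show ?thesis by (intro word_class_relator) blast
    next
      case False
      then obtain as a bs b cs where ds: "ds = as @ a # bs @ b # cs" and eq: "fst a = fst b"
        using not_distinct_map_decomp by blast
      note paths = edge_path_between[OF 1(2)[unfolded ds]]
      \<comment> \<open>One edge entered from two different vertices is traversed in opposite
        directions.\<close>
      have "initial \<Gamma> a \<noteq> initial \<Gamma> b" using initial ds by auto
      with eq have "snd a \<noteq> snd b" by (cases "snd a"; cases "snd b") (auto simp: initial_def)
      with eq have b: "b = inv_letter a" by (simp add: inv_letter_def prod_eq_iff)
      \<comment> \<open>An edge strictly between \<open>a\<close> and its inverse would start where
        \<open>b\<close> starts, against distinctness of the initial vertices.\<close>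
      have "bs = []"
      proof (cases bs)
        case (Cons x xs)
        with paths(2) b have "initial \<Gamma> x = initial \<Gamma> b" by simp
        with initial ds Cons show ?thesis by auto
      qed simp
      with paths b have inner: "edge_path \<Gamma> u (as @ cs) u" by (auto simp: edge_path_append)
      have "cancel_cons (label \<Gamma> (fst a), snd a) (cancel_cons (label \<Gamma> (fst a), \<not> snd a)
          (free_reduction (path_label \<Gamma> cs))) = free_reduction (path_label \<Gamma> cs)"
        using cancel_cons_inv_letter[of "free_reduction (path_label \<Gamma> cs)" "(label \<Gamma> (fst a), snd a)"]
        by simp
      then have red: "free_reduction (path_label \<Gamma> ds) = free_reduction (path_label \<Gamma> (as @ cs))"
        by (simp add: ds b \<open>bs = []\<close> free_reduction_append free_reduction_Cons inv_letter_def)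
      have "cls (path_label \<Gamma> ds) = cls (free_reduction (path_label \<Gamma> ds))"
        by (rule word_class_free_reduction[symmetric])
      also have "\<dots> = cls (path_label \<Gamma> (as @ cs))"
        unfolding red by (rule word_class_free_reduction)
      also have "\<dots> = \<one>\<^bsub>P\<^esub>"
        by (rule 1(1)[rule_format, of _ u]) (use inner in \<open>simp_all add: ds\<close>)
      finally show ?thesis .
    qed
  qed
qed

end


section \<open>The covering graph of a subgroup\<close>

locale graph_cover = labelled_graph S \<Gamma>
  for S :: "'s set" and \<Gamma> :: "('v, 'e, 's) labelled_graph" +
  fixes H assumes subgroup_cover: "subgroup H P"
begin

sublocale presentation_subgroup S graph_relators H
  by (intro presentation_subgroup.intro presentation_subgroup_axioms.intro presentation_axioms subgroup_cover)

text \<open>The coset in the name of an edge, and hence in its label, is the sheet of its tail. This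
  is the convention of \<open>lift_word\<close>, so labels of lifted paths are lifted
  labels.\<close>

definition cover :: "('v \<times> 's word set set, 'e \<times> 's word set set, 's \<times> 's word set set) labelled_graph" where
  "cover = \<lparr>verts = verts \<Gamma> \<times> C, arcs = arcs \<Gamma> \<times> C,
     tail = (\<lambda>(e, c). (tail \<Gamma> e, c)), head = (\<lambda>(e, c). (head \<Gamma> e, act c (label \<Gamma> e, True))),
     label = (\<lambda>(e, c). (label \<Gamma> e, c))\<rparr>"

lemma cover_simps [simp]:
  "verts cover = verts \<Gamma> \<times> C" "arcs cover = arcs \<Gamma> \<times> C"
  "tail cover (e, c) = (tail \<Gamma> e, c)" "head cover (e, c) = (head \<Gamma> e, act c (label \<Gamma> e, True))"
  "label cover (e, c) = (label \<Gamma> e, c)"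
  by (simp_all add: cover_def)

lemma labelled_cover: "labelled_by (S \<times> C) cover"
  unfolding labelled_by_def wf_digraph_def
  by (auto simp: pre_digraph.truncate_def cover_def label_in ends_in_verts coset_act_cls)

sublocale cover: labelled_graph "S \<times> C" cover
  by unfold_locales (rule labelled_cover)

abbreviation project :: "(('e \<times> 's word set set) \<times> bool) list \<Rightarrow> ('e \<times> bool) list" where
  "project \<equiv> map (map_prod fst id)"

definition lift_path :: "'s word set set \<Rightarrow> ('e \<times> bool) list \<Rightarrow> (('e \<times> 's word set set) \<times> bool) list" where
  "lift_path = lift_word (\<lambda>c d. act c (label \<Gamma> (fst d), snd d))"

lemma lift_path_simps [simp]:
  "lift_path c [] = []"
  "lift_path c (d # ds) =
     ((fst d, if snd d then c else act c (label \<Gamma> (fst d), snd d)), snd d) #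
     lift_path (act c (label \<Gamma> (fst d), snd d)) ds"
  by (simp_all add: lift_path_def)

lemma project_lift_path [simp]: "project (lift_path c ds) = ds"
  by (simp add: lift_path_def)

lemma label_lift_path: "path_label cover (lift_path c ds) = lift c (path_label \<Gamma> ds)"
  by (induction ds arbitrary: c) auto

lemma project_label: "map (map_prod fst id) (path_label cover ds) = path_label \<Gamma> (project ds)"
  by (induction ds) (auto simp: split_beta cover_def)

lemma fst_initial: "fst (initial cover d) = initial \<Gamma> (map_prod fst id d)"
  and fst_terminal: "fst (terminal cover d) = terminal \<Gamma> (map_prod fst id d)"
  by (simp_all add: initial_def terminal_def cover_def split_beta)

lemma act_cancel:
  assumes "c \<in> C" "s \<in> S"
  shows "act (act c (s, b)) (s, \<not> b) = c"
  using act_inv_letter[of c "(s, b)"] assms by simp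

lemma edge_path_lift:
  "edge_path \<Gamma> u ds v \<Longrightarrow> c \<in> C \<Longrightarrow>
    edge_path cover (u, c) (lift_path c ds) (v, c #>\<^bsub>P\<^esub> cls (path_label \<Gamma> ds))"
proof (induction ds arbitrary: u c)
  case (Cons d ds)
  let ?c = "act c (label \<Gamma> (fst d), snd d)"
  have d: "fst d \<in> arcs \<Gamma>" "initial \<Gamma> d = u" and ds: "edge_path \<Gamma> (terminal \<Gamma> d) ds v"
    using Cons.prems by simp_all
  let ?e = "((fst d, if snd d then c else ?c), snd d)"
  have s: "label \<Gamma> (fst d) \<in> S" and c: "?c \<in> C"
    using d(1) Cons.prems(2) by (simp_all add: coset_act_cls label_in)
  have "?c #>\<^bsub>P\<^esub> cls (path_label \<Gamma> ds) = c #>\<^bsub>P\<^esub> cls (path_label \<Gamma> (d # ds))"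
    using coset_act_Cons[OF Cons.prems(2), of "(label \<Gamma> (fst d), snd d)" "path_label \<Gamma> ds"]
      path_label_in_words[OF ds] s by simp
  from Cons.IH[OF ds c, unfolded this]
  have "edge_path cover (terminal \<Gamma> d, ?c) (lift_path ?c ds) (v, c #>\<^bsub>P\<^esub> cls (path_label \<Gamma> (d # ds)))" .
  moreover have "initial cover ?e = (u, c)" "terminal cover ?e = (terminal \<Gamma> d, ?c)"
    using d(2) act_cancel[OF Cons.prems(2) s, of False]
    by (cases "snd d"; simp add: initial_def terminal_def)+
  moreover have "fst ?e \<in> arcs cover" using d(1) c Cons.prems(2) by (cases "snd d") simp_all
  ultimately show ?case by (simp only: lift_path_simps edge_path.simps simp_thms)
qed auto

text \<open>Unique path lifting, the converse of \<open>edge_path_lift\<close>: following the sheets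
  letter by letter shows that the coset coordinates of all edges are forced. Paths of the cover thus
  amount to paths of \<Gamma> with a starting sheet.\<close>

lemma edge_path_project:
  assumes "edge_path cover u ds v"
  shows "edge_path \<Gamma> (fst u) (project ds) (fst v)" "snd u \<in> C" "lift_path (snd u) (project ds) = ds"
    "snd v = snd u #>\<^bsub>P\<^esub> cls (path_label \<Gamma> (project ds))"
proof -
  have "edge_path \<Gamma> (fst u) (project ds) (fst v) \<and> snd u \<in> C \<and> lift_path (snd u) (project ds) = ds \<and>
      snd v = snd u #>\<^bsub>P\<^esub> cls (path_label \<Gamma> (project ds))"
    using assms
  proof (induction ds arbitrary: u)
    case (Cons d ds)
    obtain e c b where d: "d = ((e, c), b)" by (metis surj_pair)
    have e: "e \<in> arcs \<Gamma>" and c: "c \<in> C" and u: "u = initial cover d"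
      and path: "edge_path cover (terminal cover d) ds v"
      using Cons.prems by (auto simp: d)
    have uC: "snd u \<in> C" using cover.edge_path_initial[OF Cons.prems] by auto
    have snd_d: "snd (terminal cover d) = act (snd u) (label \<Gamma> e, b)"
      using act_cancel[OF c label_in[OF e], of True]
      by (cases b) (auto simp: d u initial_def terminal_def)
    note IH = Cons.IH[OF path]
    have lab: "path_label \<Gamma> (project ds) \<in> words S"
      using IH path_label_in_words by blast
    have "c = (if b then snd u else act (snd u) (label \<Gamma> e, b))"
      using snd_d by (cases b) (auto simp: d u initial_def terminal_def)
    moreover have "(snd u #>\<^bsub>P\<^esub> cls [(label \<Gamma> e, b)]) #>\<^bsub>P\<^esub> cls (path_label \<Gamma> (project ds)) =
        snd u #>\<^bsub>P\<^esub> cls (path_label \<Gamma> (project (d # ds)))"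
      using coset_act_Cons[OF uC, of "(label \<Gamma> e, b)" "path_label \<Gamma> (project ds)"] label_in[OF e] lab
      by (simp add: d)
    moreover have "initial \<Gamma> (e, b) = fst u" "terminal \<Gamma> (e, b) = fst (terminal cover d)"
      by (simp_all add: u d fst_initial fst_terminal)
    ultimately show ?case using IH e uC unfolding snd_d by (simp add: d id_def)
  qed auto
  then show "edge_path \<Gamma> (fst u) (project ds) (fst v)" "snd u \<in> C" "lift_path (snd u) (project ds) = ds"
    "snd v = snd u #>\<^bsub>P\<^esub> cls (path_label \<Gamma> (project ds))" by blast+
qed

text \<open>Local injectivity of the projection: each generator permutes the cosets, so the sheet at
  either end of an edge determines the sheet of its tail.\<close>

lemma backtrack_lift:
  assumes "fst a \<in> arcs cover" "fst b \<in> arcs cover" "terminal cover a = initial cover b"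
    and "map_prod fst id b = inv_letter (map_prod fst id a)"
  shows "b = inv_letter a"
proof -
  obtain e c \<beta> where a: "a = ((e, c), \<beta>)" by (metis surj_pair)
  with assms(4) obtain c' where b: "b = ((e, c'), \<not> \<beta>)" by (cases b) auto
  have "label \<Gamma> e \<in> S" "c \<in> C" "c' \<in> C" using assms a b by (auto simp: label_in)
  then have "c' = c"
    using assms(3) act_cancel[of c "label \<Gamma> e" True] act_cancel[of c' "label \<Gamma> e" True]
    by (cases \<beta>) (auto simp: a b initial_def terminal_def)
  then show ?thesis by (simp add: a b)
qed

lemma immersed_project:
  assumes "immersed_path cover u ds"
  shows "immersed_path \<Gamma> (fst u) (project ds)"
proof -
  obtain v where path: "edge_path cover u ds v" and red: "successively (\<lambda>d d'. d' \<noteq> inv_letter d) ds"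
    using assms by (auto simp: immersed_path_def)
  have "successively (\<lambda>d d'. d' \<noteq> inv_letter d) (project ds)"
    using path red
  proof (induction ds arbitrary: u)
    case (Cons a ds)
    show ?case
    proof (cases ds)
      case (Cons b es)
      have "b \<noteq> inv_letter a" "fst a \<in> arcs cover" "fst b \<in> arcs cover" "terminal cover a = initial cover b"
        using Cons.prems \<open>ds = b # es\<close> by auto
      then have "map_prod fst id b \<noteq> inv_letter (map_prod fst id a)"
        using backtrack_lift by blast
      moreover have "successively (\<lambda>d d'. d' \<noteq> inv_letter d) (project ds)"
        using Cons.prems by (intro Cons.IH[of "terminal cover a"]) (auto simp: successively_Cons)
      ultimately show ?thesis unfolding Cons by (simp only: list.map successively.simps simp_thms)
    qed simp
  qed simp
  then show ?thesis using edge_path_project(1)[OF path] by (auto simp: immersed_path_def)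
qed

text \<open>The label is trivial in the group by \<open>closed_path_trivial\<close>, so the lift
  closes up in its sheet; distinctness can be tested after projection.\<close>

lemma simple_closed_lift:
  assumes "simple_closed_path \<Gamma> u ds" "c \<in> C"
  shows "simple_closed_path cover (u, c) (lift_path c ds)"
proof -
  have path: "edge_path \<Gamma> u ds u" using assms by (simp add: simple_closed_path_def)
  have "edge_path cover (u, c) (lift_path c ds) (u, c)"
    using edge_path_lift[OF path assms(2)] closed_path_trivial[OF path] assms(2) by simp
  moreover have "map (initial \<Gamma>) (project xs) = map fst (map (initial cover) xs)"
    "map fst (project xs) = map fst (map fst xs)" for xs
    by (simp_all add: fst_initial)
  from this[of "lift_path c ds"] have "distinct (map fst (map (initial cover) (lift_path c ds)))"
    "distinct (map fst (map fst (lift_path c ds)))"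
    using assms(1) unfolding simple_closed_path_def project_lift_path by simp_all
  ultimately show ?thesis
    unfolding simple_closed_path_def by (blast dest: distinct_map[THEN iffD1])
qed

text \<open>If two vertices on the path had the same projection, the stretch between them would
  project to a closed path, whose label is trivial, so they would lie in the same sheet and
  coincide. A repeated projected edge would lift to a backtrack of the path in the cover.\<close>

lemma simple_closed_project:
  assumes "simple_closed_path cover u ds"
  shows "simple_closed_path \<Gamma> (fst u) (project ds)"
proof -
  have path: "edge_path cover u ds u" and dist: "distinct (map (initial cover) ds)" "distinct (map fst ds)"
    using assms by (auto simp: simple_closed_path_def)
  have initial: "distinct (map (initial \<Gamma>) (project ds))"
  proof (rule ccontr)
    assume "\<not> distinct (map (initial \<Gamma>) (project ds))"
    then have "\<not> distinct (map (\<lambda>d. fst (initial cover d)) ds)" by (simp add: fst_initial comp_def)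
    then obtain as a bs b cs where ds: "ds = as @ a # bs @ b # cs"
      and eq: "fst (initial cover a) = fst (initial cover b)"
      using not_distinct_map_decomp by blast
    note between = cover.edge_path_between(2)[OF path[unfolded ds]]
    have "cls (path_label \<Gamma> (project (a # bs))) = \<one>\<^bsub>P\<^esub>"
      using edge_path_project(1)[OF between] unfolding eq by (rule closed_path_trivial)
    then have "snd (initial cover a) = snd (initial cover b)"
      using edge_path_project(2,4)[OF between] by simp
    with eq have "initial cover a = initial cover b" by (simp add: prod_eq_iff)
    with dist ds show False by auto
  qed
  have "distinct (map fst (project ds))"
  proof (rule ccontr)
    assume "\<not> distinct (map fst (project ds))"
    then have "\<not> distinct (map (\<lambda>d. fst (fst d)) ds)" by (simp add: comp_def)
    then obtain as a bs b cs where ds: "ds = as @ a # bs @ b # cs" and eq: "fst (fst a) = fst (fst b)"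
      using not_distinct_map_decomp by blast
    let ?a = "map_prod fst id a" and ?b = "map_prod fst id b"
    have "initial \<Gamma> ?a \<noteq> initial \<Gamma> ?b" using initial ds by auto
    with eq have "snd a \<noteq> snd b" by (cases "snd a"; cases "snd b") (auto simp: initial_def)
    with eq have b: "?b = inv_letter ?a" by (simp add: inv_letter_def prod_eq_iff)
    note between = cover.edge_path_between[OF path[unfolded ds]]
    have "bs = []"
    proof (cases bs)
      case (Cons x xs)
      with between(2) have "initial cover x = terminal cover a" by simp
      then have "initial \<Gamma> (map_prod fst id x) = initial \<Gamma> ?b"
        by (metis b fst_initial fst_terminal initial_inv_letter)
      with initial ds Cons show ?thesis by auto
    qed simp
    with between have "terminal cover a = initial cover b" "fst a \<in> arcs cover" "fst b \<in> arcs cover"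
      by auto
    with b have "b = inv_letter a" by (intro backtrack_lift) auto
    with dist(2) ds show False by (simp add: inv_letter_def)
  qed
  with initial edge_path_project(1)[OF path] show ?thesis by (simp add: simple_closed_path_def)
qed

text \<open>Projection and lifting match simple closed paths of the cover with those of \<Gamma>
  together with a starting sheet. This identifies the group of the cover with
  \<open>L.P\<close>.\<close>

lemma cover_relators: "cover.graph_relators = lifted_relators"
proof (intro equalityI subsetI)
  fix w assume "w \<in> cover.graph_relators"
  then obtain u ds where ds: "simple_closed_path cover u ds" "w = path_label cover ds" by blast
  then have "edge_path cover u ds u" by (simp add: simple_closed_path_def)
  from edge_path_project(2,3)[OF this] have "w = lift (snd u) (path_label \<Gamma> (project ds))" "snd u \<in> C"
    unfolding ds(2) label_lift_path[symmetric] by simp_all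
  with simple_closed_project[OF ds(1)] show "w \<in> lifted_relators"
    unfolding lifted_relators_def by blast
next
  fix w assume "w \<in> lifted_relators"
  then obtain c u ds where "c \<in> C" "simple_closed_path \<Gamma> u ds" "w = lift c (path_label \<Gamma> ds)"
    unfolding lifted_relators_def by blast
  then have "simple_closed_path cover (u, c) (lift_path c ds)" "w = path_label cover (lift_path c ds)"
    by (auto simp: label_lift_path intro: simple_closed_lift)
  then show "w \<in> cover.graph_relators" by blast
qed

lemma graph_group_cover: "graph_group (S \<times> C) cover \<cong> free_product (P\<lparr>carrier := H\<rparr>) (free_group (C - {H}))"
  using lifted_presentation_iso by (simp only: cover.graph_group_eq cover_relators)

end


section \<open>Transfer of the small cancellation conditions to the cover\<close>

lemma bij_betw_map_prod_id: "bij_betw f A B \<Longrightarrow> bij_betw (map_prod f id) (A \<times> C) (B \<times> C)"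
  unfolding bij_betw_def by (simp add: map_prod_inj_on map_prod_surj_on)

lemma initial_automorphism:
  assumes "label_automorphism \<Gamma> \<phi>\<^sub>V \<phi>\<^sub>E" "fst d \<in> arcs \<Gamma>"
  shows "initial \<Gamma> (map_prod \<phi>\<^sub>E id d) = \<phi>\<^sub>V (initial \<Gamma> d)"
  using assms by (auto simp: label_automorphism_def initial_def)

lemma freely_reduced_map_fst:
  "freely_reduced (map (map_prod fst id) w) \<Longrightarrow> freely_reduced w"
  unfolding freely_reduced_def successively_map
  by (erule successively_mono) (auto simp: inv_letter_def)

context graph_cover
begin

lemma label_automorphism_cover:
  assumes "label_automorphism \<Gamma> \<phi>\<^sub>V \<phi>\<^sub>E"
  shows "label_automorphism cover (map_prod \<phi>\<^sub>V id) (map_prod \<phi>\<^sub>E id)"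
  using assms by (auto simp: label_automorphism_def bij_betw_map_prod_id)

text \<open>The common label supplies the coset coordinates of the edges, and the projections supply
  the edges of \<Gamma>.\<close>

lemma automorphism_lift_path:
  assumes "path_label cover ds = path_label cover es" "project ds = map (map_prod \<phi> id) (project es)"
  shows "ds = map (map_prod (map_prod \<phi> id) id) es"
  using assms
proof (induction ds arbitrary: es)
  case (Cons d ds)
  then obtain e es' where es: "es = e # es'" by (cases es) auto
  with Cons.prems have "ds = map (map_prod (map_prod \<phi> id) id) es'"
    by (intro Cons.IH) simp_all
  moreover have "d = map_prod (map_prod \<phi> id) id e"
    using Cons.prems es by (cases d; cases e) (auto simp: cover_def)
  ultimately show ?case by (simp only: es list.map)
qed simp

text \<open>An automorphism of \<open>\<Gamma>\<close> lifts to the cover by acting trivially on the coset coordinate. The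
  label of a nonempty path of the cover determines the coset coordinates of all its edges and of its
  initial vertex; for the empty path this fails.\<close>

lemma piece_project:
  assumes "piece cover w" "w \<noteq> []"
  shows "piece \<Gamma> (map (map_prod fst id) w)"
proof -
  obtain u\<^sub>1 ds\<^sub>1 u\<^sub>2 ds\<^sub>2 where imm: "immersed_path cover u\<^sub>1 ds\<^sub>1" "immersed_path cover u\<^sub>2 ds\<^sub>2"
    and lab: "path_label cover ds\<^sub>1 = w" "path_label cover ds\<^sub>2 = w"
    and dist: "essentially_distinct cover (u\<^sub>1, ds\<^sub>1) (u\<^sub>2, ds\<^sub>2)"
    using assms(1) by (auto simp: piece_def immersion_of_def)
  have "essentially_distinct \<Gamma> (fst u\<^sub>1, project ds\<^sub>1) (fst u\<^sub>2, project ds\<^sub>2)"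
    unfolding essentially_distinct_def
  proof (intro notI, elim exE conjE)
    fix \<phi>\<^sub>V \<phi>\<^sub>E
    assume aut: "label_automorphism \<Gamma> \<phi>\<^sub>V \<phi>\<^sub>E"
      and eq: "(fst u\<^sub>1, project ds\<^sub>1) = map_prod \<phi>\<^sub>V (map (map_prod \<phi>\<^sub>E id)) (fst u\<^sub>2, project ds\<^sub>2)"
    note aut' = label_automorphism_cover[OF aut]
    have ds: "ds\<^sub>1 = map (map_prod (map_prod \<phi>\<^sub>E id) id) ds\<^sub>2"
      using lab eq by (intro automorphism_lift_path) simp_all
    obtain d es where ds2: "ds\<^sub>2 = d # es" using lab(2) assms(2) by (cases ds\<^sub>2) auto
    have "u\<^sub>1 = initial cover (map_prod (map_prod \<phi>\<^sub>E id) id d)" "u\<^sub>2 = initial cover d" "fst d \<in> arcs cover"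
      using imm by (auto simp: ds ds2 immersed_path_def)
    then have "u\<^sub>1 = map_prod \<phi>\<^sub>V id u\<^sub>2" using initial_automorphism[OF aut'] by simp
    then have "(u\<^sub>1, ds\<^sub>1) =
        map_prod (map_prod \<phi>\<^sub>V id) (map (map_prod (map_prod \<phi>\<^sub>E id) id)) (u\<^sub>2, ds\<^sub>2)"
      by (subst ds) simp
    with aut' dist show False unfolding essentially_distinct_def by blast
  qed
  moreover have "immersion_of (map (map_prod fst id) w) \<Gamma> (fst u\<^sub>1, project ds\<^sub>1)"
    "immersion_of (map (map_prod fst id) w) \<Gamma> (fst u\<^sub>2, project ds\<^sub>2)"
    using immersed_project[OF imm(1)] immersed_project[OF imm(2)]
      project_label[of ds\<^sub>1] project_label[of ds\<^sub>2] lab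
    by (simp_all add: immersion_of_def)
  ultimately show ?thesis unfolding piece_def by blast
qed

lemma reduced_labelling_cover:
  assumes "reduced_labelling \<Gamma>"
  shows "reduced_labelling cover"
  unfolding reduced_labelling_def
proof (intro allI impI)
  fix u ds assume "immersed_path cover u ds"
  then have "freely_reduced (path_label \<Gamma> (project ds))"
    using assms immersed_project unfolding reduced_labelling_def by blast
  then show "freely_reduced (path_label cover ds)"
    unfolding project_label[symmetric] by (rule freely_reduced_map_fst)
qed

lemma Gr_cover:
  assumes "Gr p \<Gamma>"
  shows "Gr p cover"
proof -
  have "reduced_labelling cover" using assms by (simp add: Gr_def reduced_labelling_cover)
  moreover have False
    if ds: "simple_closed_path cover u ds" "ds \<noteq> []" "ds = concat qs"
      and len: "length qs < p" and pieces: "\<forall>q \<in> set qs. piece cover (path_label cover q)" for u ds qs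
  proof -
    \<comment> \<open>Empty factors are dropped because \<open>piece_project\<close> speaks of
      nonempty words only; this leaves the concatenation unchanged and does not increase the number
      of factors.\<close>
    let ?qs = "map project (filter (\<lambda>q. q \<noteq> []) qs)"
    have "concat (filter (\<lambda>q. q \<noteq> []) qs) = concat qs"
      by (induction qs) auto
    then have "project ds = concat ?qs" by (simp only: ds(3) map_concat[symmetric])
    moreover have "length ?qs < p"
      unfolding length_map using length_filter_le len by (rule le_less_trans)
    moreover have "piece \<Gamma> (path_label \<Gamma> (project q))" if "q \<in> set qs" "q \<noteq> []" for q
      using pieces piece_project[of "path_label cover q"] that by (simp add: project_label)
    then have "\<forall>q \<in> set ?qs. piece \<Gamma> (path_label \<Gamma> q)" by auto
    ultimately show False
      using assms simple_closed_project[OF ds(1)] ds(2) unfolding Gr_def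
      by (metis (no_types, lifting) map_is_Nil_conv)
  qed
  ultimately show ?thesis unfolding Gr_def by blast
qed

text \<open>The two lengths are kept abstract so that word length and free product length are both
  instances. All labels involved are reduced before and after projection, so \<open>l'\<close> is
  only compared with \<open>l\<close> on reduced words.\<close>

lemma Gr'_len_cover:
  assumes "lam > 0" and Gr': "Gr'_len l lam \<Gamma>" and Nil: "l [] = 0" "l' [] = 0"
    and pos: "\<And>w. w \<in> words S \<Longrightarrow> freely_reduced w \<Longrightarrow> w \<noteq> [] \<Longrightarrow> l w > 0"
    and l': "\<And>w. w \<in> words (S \<times> C) \<Longrightarrow> freely_reduced w \<Longrightarrow>
      freely_reduced (map (map_prod fst id) w) \<Longrightarrow> l' w = l (map (map_prod fst id) w)"
  shows "Gr'_len l' lam cover"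
  unfolding Gr'_len_def
proof (intro conjI allI impI)
  have red: "reduced_labelling \<Gamma>" using Gr' by (simp add: Gr'_len_def)
  then show red': "reduced_labelling cover" by (rule reduced_labelling_cover)
  fix u ds q
  assume ds: "simple_closed_path cover u ds" "ds \<noteq> []" and q: "sublist q ds"
    and piece: "piece cover (path_label cover q)"
  have path: "edge_path cover u ds u" using ds by (simp add: simple_closed_path_def)
  have immersed: "\<exists>w. immersed_path cover w xs" if "sublist xs ds" for xs
    using cover.immersed_sublist[OF path cover.simple_closed_path_immersed[OF ds(1)] that] .
  have reduced: "freely_reduced (path_label cover xs) \<and> freely_reduced (path_label \<Gamma> (project xs)) \<and>
      path_label cover xs \<in> words (S \<times> C) \<and> path_label \<Gamma> (project xs) \<in> words S"
    if sub: "sublist xs ds" for xs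
  proof -
    obtain w where w: "immersed_path cover w xs" using immersed[OF sub] by blast
    then obtain v where "edge_path cover w xs v" by (auto simp: immersed_path_def)
    then have "path_label cover xs \<in> words (S \<times> C)" by (rule cover.path_label_in_words)
    moreover from this have "path_label \<Gamma> (project xs) \<in> words S"
      unfolding project_label[symmetric] by (rule map_fst_in_words)
    ultimately show ?thesis
      using w immersed_project[OF w] red red' unfolding reduced_labelling_def by blast
  qed
  have l'_eq: "l' (free_reduction (path_label cover xs)) = l (free_reduction (path_label \<Gamma> (project xs)))"
    if "sublist xs ds" for xs
    using reduced[OF that] l'[of "path_label cover xs"] by (simp add: project_label)
  have closed: "simple_closed_path \<Gamma> (fst u) (project ds)" "project ds \<noteq> []"
    using simple_closed_project[OF ds(1)] ds(2) by simp_all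
  show "real (l' (free_reduction (path_label cover q)))
      < lam * real (l' (free_reduction (path_label cover ds)))"
  proof (cases "q = []")
    case True
    \<comment> \<open>For the empty subpath, \<open>piece_project\<close> does not apply. The left
      side is then zero, and the right side is positive because the label of the nonempty closed
      path is a nonempty reduced word.\<close>
    have "l (free_reduction (path_label \<Gamma> (project ds))) > 0"
      using reduced[of ds] closed(2) pos by simp
    then show ?thesis using True assms(1) by (simp add: Nil l'_eq)
  next
    case False
    have "piece \<Gamma> (path_label \<Gamma> (project q))"
      using piece_project[OF piece] False by (simp add: project_label)
    moreover have "sublist (project q) (project ds)"
      using q by (rule map_mono_sublist)
    ultimately show ?thesis
      using Gr' closed l'_eq[OF q] l'_eq[of ds] unfolding Gr'_len_def by simp
  qed
qed

lemma Gr'_cover: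
  assumes "lam > 0" "Gr' lam \<Gamma>"
  shows "Gr' lam cover"
  using assms unfolding Gr'_def 
  by (rule Gr'_len_cover[where l = length and l' = length]) auto

lemma Gr'_star_cover:
  assumes "lam > 0" "partition_on S \<P>" "Gr'_star \<P> lam \<Gamma>"
  shows "Gr'_star ((\<lambda>P. P \<times> C) ` \<P>) lam cover"
proof -
  have \<P>: "disjoint \<P>" "\<Union> \<P> = S" using assms(2) by (auto simp: partition_on_def)
  have \<P>': "disjoint ((\<lambda>P. P \<times> C) ` \<P>)" using \<P>(1) by (auto simp: disjoint_def)
  show ?thesis
    using assms(3) unfolding Gr'_star_def
  proof (rule Gr'_len_cover[OF assms(1)])
    show "free_product_length \<P> [] = 0" "free_product_length ((\<lambda>P. P \<times> C) ` \<P>) [] = 0"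
      using \<P>(1) \<P>' by (simp_all add: free_product_length_eq)
    show "free_product_length \<P> w > 0" if "w \<in> words S" "freely_reduced w" "w \<noteq> []" for w
      using \<P> that by (simp add: free_product_length_eq)
    show "free_product_length ((\<lambda>P. P \<times> C) ` \<P>) w = free_product_length \<P> (map (map_prod fst id) w)"
      if "w \<in> words (S \<times> C)" "freely_reduced w" "freely_reduced (map (map_prod fst id) w)" for w
      using \<P> that by (intro free_product_length_times) simp_all
  qed
qed

end

text \<open>Removing a point from an infinite set keeps its cardinality, in accordance with the
  convention for infinite index.\<close>

lemma has_card_minus_one_remove:
  assumes "x \<in> A"
  shows "has_card_minus_one (A - {x}) A"
proof (cases "finite A")
  case False
  then have "insert x (A - {x}) \<approx> A - {x}" by (intro infinite_insert_eqpoll) simp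
  with assms False show ?thesis
    by (simp add: has_card_minus_one_def insert_absorb eqpoll_sym)
qed (use assms in \<open>simp add: has_card_minus_one_def\<close>)

theorem proposition1:
  fixes p :: nat and lam :: real
    and S :: "'s set" and \<Gamma> :: "('v, 'e, 's) labelled_graph"
    and H :: "'s word set set"
  assumes "lam > 0"
    and "labelled_by S \<Gamma>"
    and "subgroup H (graph_group S \<Gamma>)"
  shows "\<exists>\<Gamma>\<^sub>H :: ('v \<times> 's word set set, 'e \<times> 's word set set, 's \<times> 's word set set) labelled_graph.
      labelled_by (S \<times> rcosets\<^bsub>graph_group S \<Gamma>\<^esub> H) \<Gamma>\<^sub>H \<and>
      (\<exists>B :: 's word set set set.
         has_card_minus_one B (rcosets\<^bsub>graph_group S \<Gamma>\<^esub> H) \<and>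
         graph_group (S \<times> rcosets\<^bsub>graph_group S \<Gamma>\<^esub> H) \<Gamma>\<^sub>H \<cong>
           free_product ((graph_group S \<Gamma>)\<lparr>carrier := H\<rparr>) (free_group B)) \<and>
      (Gr p \<Gamma> \<longrightarrow> Gr p \<Gamma>\<^sub>H) \<and>
      (Gr' lam \<Gamma> \<longrightarrow> Gr' lam \<Gamma>\<^sub>H) \<and>
      (\<forall>\<P>. partition_on S \<P> \<longrightarrow> Gr'_star \<P> lam \<Gamma> \<longrightarrow>
         Gr'_star ((\<lambda>P. P \<times> rcosets\<^bsub>graph_group S \<Gamma>\<^esub> H) ` \<P>) lam \<Gamma>\<^sub>H)"
proof -
  interpret labelled_graph S \<Gamma> using assms(2) by (rule labelled_graph.intro)
  interpret graph_cover S \<Gamma> H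
    using assms(3) unfolding graph_group_eq
    by (intro graph_cover.intro graph_cover_axioms.intro labelled_graph_axioms)
  \<comment> \<open>The graph is \<open>cover\<close>, and the free factor has the basis
    \<open>C - {H}\<close> of cosets other than \<open>H\<close>.\<close>
  show ?thesis
    unfolding graph_group_eq
    using labelled_cover has_card_minus_one_remove[OF H_in_cosets] graph_group_cover
      Gr_cover[of p] Gr'_cover[OF assms(1)] Gr'_star_cover[OF assms(1)]
    by (intro exI[of _ cover] conjI exI[of _ "C - {H}"] allI impI) blast+
qed

end
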